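(* For all integers $m\ge 0$ and $n\ge 0$, \[N_{\le m}(n)\ \ge\ M_{\le m}(n).\]
   Context: For a partition $\lambda$ with parts $\lambda_1\ge\cdots\ge\lambda_\ell>0$, its rank is $\lambda_1-\ell$. Its crank is $\lambda_1$ if $\lambda$ has no part equal to $1$, and otherwise is (the number of parts of $\lambda$ larger than $\omega(\lambda)$) minus $\omega(\lambda)$, where $\omega(\lambda)$ is the number of parts equal to $1$. $N(m,n)$ is the number of partitions of $n$ with rank $m$; for $n\ge 2$, $M(m,n)$ is the number of partitions of $n$ with crank $m$. Conventions: $N(0,0)=M(0,0)=1$ and $N(m,0)=M(m,0)=0$ for $m\ne 0$; for $n=1$ one sets $M(0,1)=-1$, $M(1,1)=M(-1,1)=1$ and $M(m,1)=0$ for $|m|\ge 2$. Define $N_{\le m}(n)=\sum_{|r|\le m}N(r,n)$ and $M_{\le m}(n)=\sum_{|r|\le m}M(r,n)$. *)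

theory Defs
  imports Main
begin

definition partitions :: "nat \<Rightarrow> nat list set" where
  "partitions n = {xs. sorted_wrt (\<ge>) xs \<and> (\<forall>x\<in>set xs. 0 < x) \<and> sum_list xs = n}"

definition largest_part :: "nat list \<Rightarrow> nat" where
  "largest_part xs = (if xs = [] then 0 else hd xs)"

definition prank :: "nat list \<Rightarrow> int" where
  "prank xs = int (largest_part xs) - int (length xs)"

definition omega :: "nat list \<Rightarrow> nat" where
  "omega xs = count_list xs 1"

definition pcrank :: "nat list \<Rightarrow> int" where
  "pcrank xs = (if omega xs = 0 then int (largest_part xs)
     else int (length (filter (\<lambda>x. x > omega xs) xs)) - int (omega xs))"

definition N :: "int \<Rightarrow> nat \<Rightarrow> int" where
  "N m n = int (card {xs \<in> partitions n. prank xs = m})"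

definition M :: "int \<Rightarrow> nat \<Rightarrow> int" where
  "M m n = (if n = 1 then (if m = 0 then -1 else if m = 1 \<or> m = -1 then 1 else 0)
            else int (card {xs \<in> partitions n. pcrank xs = m}))"

definition N_le :: "nat \<Rightarrow> nat \<Rightarrow> int" where
  "N_le m n = (\<Sum>r\<in>{-int m..int m}. N r n)"

definition M_le :: "nat \<Rightarrow> nat \<Rightarrow> int" where
  "M_le m n = (\<Sum>r\<in>{-int m..int m}. M r n)"

end

theory Submission
  imports Defs "HOL-Computational_Algebra.Formal_Power_Series"
begin

text \<open>
  Write \<open>1/(q)\<^sub>k\<close> for \<open>1/((1 - q)\<dots>(1 - q\<^sup>k))\<close>, \<open>h\<^sub>r(a)\<close> for the Gaussian binomial \<open>[a + r - 1; r]\<close>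
  (multisets of size \<open>r\<close> from \<open>{0..a - 1}\<close>, counted by sum), and put
  \<open>X(a, b) = q\<^bsup>ab\<^esup> \<Sum>\<^sub>r q\<^sup>r h\<^sub>r(a) h\<^sub>r(b)\<close>, \<open>F\<^sub>m = \<Sum>\<^bsub>a \<ge> 1\<^esub> X(a, a + m)\<close>.

  Removing the hook of a partition and applying the q-Vandermonde identity gives, for \<open>c \<ge> 0\<close>,
  \<open>N(\<plusminus>c) = [c = 0] + \<Sum>\<^sub>a q\<^bsup>ab\<^esup> \<Sum>\<^sub>r q\<^bsup>2r\<^esup> h\<^sub>r(a) h\<^sub>r(b)\<close>; splitting a partition with \<open>k\<close> ones into its
  parts \<open>> k\<close>, its parts in \<open>{2..k}\<close> and its ones gives
  \<open>M(\<plusminus>c) = (1 - q) \<Sum>\<^sub>a q\<^bsup>ab - 1\<^esup> / ((q)\<^bsub>a - 1\<^esub> (q)\<^bsub>b - 1\<^esub>)\<close>, where \<open>b = a + c\<close> in both sums.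
  Contiguity relations for \<open>X\<close> and a telescoping sum then yield
  \<open>N(c) - M(c) = 2 F\<^sub>c - F\<^bsub>c + 1\<^esub> - F\<^bsub>|c - 1|\<^esub>\<close>, so that the difference in the theorem is
  \<open>2 (F\<^sub>m - F\<^bsub>m + 1\<^esub>)\<close>.

  To see \<open>F\<^sub>m \<ge> F\<^bsub>m + 1\<^esub>\<close>, embed \<open>X = W\<^sub>0\<close> in a family \<open>W\<^sub>t(a, b)\<close> divisible by \<open>q\<close> to the power \<open>t\<^sup>2\<close> with
  \<open>W\<^sub>t(a, b) = q\<^bsup>b + t\<^esup> W\<^sub>t(a - 1, b) + q\<^bsup>a + t\<^esup> W\<^sub>t(a, b) + W\<^bsub>t + 1\<^esub>(a, b)\<close>, and compare
  \<open>\<Sum>\<^sub>a W\<^sub>t(a, a + m)\<close> with \<open>\<Sum>\<^sub>a W\<^sub>t(a + m + 1, a)\<close>. The recurrence turns their difference at level \<open>t\<close> into the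
  one at level \<open>t + 1\<close>, plus terms that are nonnegative because \<open>W\<^sub>t(a, b) \<ge> W\<^sub>t(b, a)\<close> for \<open>a \<le> b\<close>, an
  instance of the total positivity of Gaussian binomials. Iterating pushes the remainder beyond any degree.
\<close>

section \<open>Formal power series with integer coefficients\<close>

unbundle fps_syntax

abbreviation q :: "int fps" where "q \<equiv> fps_X"

definition fps_nonneg :: "int fps \<Rightarrow> bool" where
  "fps_nonneg f \<longleftrightarrow> (\<forall>n. 0 \<le> f $ n)"

lemma fps_nonneg_0 [simp]: "fps_nonneg 0"
  and fps_nonneg_1 [simp]: "fps_nonneg 1"
  and fps_nonneg_X_power [simp]: "fps_nonneg (q ^ k)"
  by (simp_all add: fps_nonneg_def fps_X_power_nth)

lemma fps_nonneg_add: "fps_nonneg f \<Longrightarrow> fps_nonneg g \<Longrightarrow> fps_nonneg (f + g)"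
  by (simp add: fps_nonneg_def)

lemma fps_nonneg_mult: "fps_nonneg f \<Longrightarrow> fps_nonneg g \<Longrightarrow> fps_nonneg (f * g)"
  by (simp add: fps_nonneg_def fps_mult_nth sum_nonneg)

text \<open>Term \<open>k\<close> must have order at least \<open>k\<close>, so every coefficient of
  the sum is a finite sum with an explicit range and no topology is involved.\<close>

definition fps_summable :: "(nat \<Rightarrow> int fps) \<Rightarrow> bool" where
  "fps_summable f \<longleftrightarrow> (\<forall>k n. n < k \<longrightarrow> f k $ n = 0)"

text \<open>
  Only meaningful for \<open>fps_summable\<close> families: the \<open>n\<close>-th coefficient ignores the terms beyond the \<open>n\<close>-th.
\<close>
definition fps_suminf :: "(nat \<Rightarrow> int fps) \<Rightarrow> int fps" where
  "fps_suminf f = Abs_fps (\<lambda>n. \<Sum>k\<le>n. f k $ n)"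

lemma fps_summable_X_power_mult: "(\<And>k. k \<le> p k) \<Longrightarrow> fps_summable (\<lambda>k. q ^ p k * f k)"
  unfolding fps_summable_def fps_X_power_mult_nth by (meson order_less_le_trans)

lemma fps_summable_Suc: "fps_summable f \<Longrightarrow> fps_summable (\<lambda>k. f (Suc k))"
  by (simp add: fps_summable_def)

lemma fps_suminf_nth:
  assumes "fps_summable f" "n \<le> m"
  shows "fps_suminf f $ n = (\<Sum>k\<le>m. f k $ n)"
proof -
  have "(\<Sum>k\<le>m. f k $ n) = (\<Sum>k\<le>n. f k $ n)"
    by (rule sum.mono_neutral_right) (use assms in \<open>auto simp: fps_summable_def\<close>)
  then show ?thesis by (simp add: fps_suminf_def)
qed

lemma fps_suminf_add: "fps_suminf (\<lambda>k. f k + g k) = fps_suminf f + fps_suminf g"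
  by (rule fps_ext) (simp add: fps_suminf_def sum.distrib)

lemma fps_suminf_diff: "fps_suminf (\<lambda>k. f k - g k) = fps_suminf f - fps_suminf g"
  by (rule fps_ext) (simp add: fps_suminf_def sum_subtractf)

text \<open>Unlike addition, a product mixes coefficients truncated at different bounds; summability
  lets all of them be summed over the common range \<open>k \<le> n\<close>.\<close>

lemma fps_suminf_mult:
  assumes "fps_summable f"
  shows "fps_suminf (\<lambda>k. c * f k) = c * fps_suminf f"
proof (rule fps_ext)
  fix n
  have "(c * fps_suminf f) $ n = (\<Sum>i=0..n. c $ i * (\<Sum>k\<le>n. f k $ (n - i)))"
    unfolding fps_mult_nth by (simp add: fps_suminf_nth[OF assms, of _ n])
  also have "\<dots> = (\<Sum>i=0..n. \<Sum>k\<le>n. c $ i * f k $ (n - i))"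
    by (simp add: sum_distrib_left)
  also have "\<dots> = (\<Sum>k\<le>n. \<Sum>i=0..n. c $ i * f k $ (n - i))"
    by (rule sum.swap)
  finally show "fps_suminf (\<lambda>k. c * f k) $ n = (c * fps_suminf f) $ n"
    by (simp add: fps_suminf_def fps_mult_nth)
qed

lemma fps_suminf_Suc:
  assumes "fps_summable f"
  shows "fps_suminf f = f 0 + fps_suminf (\<lambda>k. f (Suc k))"
proof (rule fps_ext)
  fix n
  have "fps_suminf f $ n = (\<Sum>k\<le>Suc n. f k $ n)"
    by (rule fps_suminf_nth[OF assms]) simp
  also have "\<dots> = f 0 $ n + (\<Sum>k\<le>n. f (Suc k) $ n)"
    by (rule sum.atMost_Suc_shift)
  finally show "fps_suminf f $ n = (f 0 + fps_suminf (\<lambda>k. f (Suc k))) $ n"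
    by (simp add: fps_suminf_def)
qed

lemma fps_nonneg_suminf: "(\<And>k. fps_nonneg (f k)) \<Longrightarrow> fps_nonneg (fps_suminf f)"
  by (simp add: fps_nonneg_def fps_suminf_def sum_nonneg)

section \<open>Gaussian binomial coefficients\<close>

fun qbinom :: "nat \<Rightarrow> nat \<Rightarrow> int fps" where
  "qbinom n 0 = 1"
| "qbinom 0 (Suc k) = 0"
| "qbinom (Suc n) (Suc k) = qbinom n k + q ^ Suc k * qbinom n (Suc k)"

lemma qbinom_eq_0: "n < k \<Longrightarrow> qbinom n k = 0"
  by (induction n k rule: qbinom.induct) auto

lemma qbinom_self [simp]: "qbinom n n = 1"
  by (induction n) (auto simp: qbinom_eq_0)

text \<open>The dual q-Pascal rule: expand by the defining rule, apply the induction hypothesis to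
  both terms and regroup. For \<open>k > n\<close> the truncated exponent is harmless, since
  \<open>qbinom n k = 0\<close>.\<close>

lemma qbinom_Suc_Suc': "qbinom (Suc n) (Suc k) = qbinom n (Suc k) + q ^ (n - k) * qbinom n k"
proof (induction n arbitrary: k)
  case (Suc n)
  consider "k = 0" | j where "k = Suc j" "j < n" | "k = Suc n" | "Suc n < k"
    by (cases k) (auto simp: not_less less_Suc_eq, force+)
  then show ?case
  proof cases
    case 1
    have "qbinom (Suc (Suc n)) (Suc 0) = 1 + q * qbinom (Suc n) 1"
      by simp
    also have "\<dots> = 1 + q * (qbinom n 1 + q ^ n)"
      using Suc[of 0] by simp
    also have "\<dots> = qbinom (Suc n) 1 + q ^ Suc n"
      by (simp add: algebra_simps)
    finally show ?thesis using 1 by simp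
  next
    case 2
    have e: "n - j = Suc (n - Suc j)" using 2 by simp
    have "qbinom (Suc (Suc n)) (Suc k) = qbinom (Suc n) (Suc j) + q ^ Suc k * qbinom (Suc n) (Suc k)"
      using 2 by simp
    also have "\<dots> = (qbinom n (Suc j) + q ^ (n - j) * qbinom n j)
        + q ^ Suc k * (qbinom n (Suc k) + q ^ (n - k) * qbinom n k)"
      using Suc[of j] Suc[of k] 2 by simp
    also have "\<dots> = (qbinom n k + q ^ Suc k * qbinom n (Suc k))
        + q ^ (n - j) * (qbinom n j + q ^ Suc j * qbinom n (Suc j))"
      using 2 e by (simp add: algebra_simps)
    finally show ?thesis using 2 by simp
  qed (auto simp: qbinom_eq_0)
qed simp

text \<open>The defining rule on one side and the dual rule on the other give the same terms up to
  the symmetry for \<open>m + n - 1\<close>.\<close>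

lemma qbinom_sym: "qbinom (m + n) m = qbinom (m + n) n"
proof (induction "m + n" arbitrary: m n)
  case (Suc s)
  show ?case
  proof (cases "m = 0 \<or> n = 0")
    case False
    then obtain i j where m: "m = Suc i" and n: "n = Suc j"
      by (meson not0_implies_Suc)
    have 1: "qbinom (i + n) i = qbinom (i + n) n" and 2: "qbinom (m + j) m = qbinom (m + j) j"
      using Suc(1)[of i n] Suc(1)[of m j] Suc(2) m n by auto
    have "qbinom (m + n) m = qbinom (i + n) i + q ^ Suc i * qbinom (i + n) (Suc i)"
      using m by simp
    also have "\<dots> = qbinom (i + n) n + q ^ (i + n - j) * qbinom (i + n) j"
      using 1 2 m n by simp
    also have "\<dots> = qbinom (m + n) n"
      using qbinom_Suc_Suc'[of "i + n" j] m n by simp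
    finally show ?thesis .
  qed auto
qed simp

lemma fps_nonneg_qbinom: "fps_nonneg (qbinom n k)"
  by (induction n k rule: qbinom.induct) (auto intro!: fps_nonneg_add fps_nonneg_mult simp del: power_Suc)

section \<open>Total positivity of Gaussian binomials\<close>

definition qbinom_minor :: "nat \<Rightarrow> nat \<Rightarrow> nat \<Rightarrow> nat \<Rightarrow> int fps" where
  "qbinom_minor n d r t = qbinom n r * qbinom (n + d) (r + t) - q ^ (t * d) * qbinom n (r + t) * qbinom (n + d) r"

text \<open>Induction on \<open>n\<close> with \<open>d\<close> fixed: by the dual Pascal rule, the
  minor with rows \<open>Suc n\<close>, \<open>Suc n + d\<close> is a combination of minors with
  rows \<open>n\<close>, \<open>n + d\<close>, with powers of \<open>q\<close> as coefficients. The
  twist \<open>q ^ (t * d)\<close> makes the exponents match.\<close>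

lemma fps_nonneg_qbinom_minor: "fps_nonneg (qbinom_minor n d r t)"
proof (induction n arbitrary: r t)
  case 0
  show ?case
    by (cases "r = 0 \<and> t = 0"; cases t; cases r) (auto simp: qbinom_minor_def intro!: fps_nonneg_mult fps_nonneg_qbinom)
next
  case (Suc n)
  \<comment> \<open>If \<open>t = 0\<close> the minor is zero, and if \<open>Suc n < r + t\<close>
    its negative product vanishes. Otherwise \<open>r + s \<le> n\<close>, so that no exponent below
    is truncated.\<close>
  show ?case
  proof (cases "t = 0 \<or> Suc n < r + t")
    case True
    then show ?thesis
      by (auto simp: qbinom_minor_def qbinom_eq_0 simp del: qbinom.simps intro!: fps_nonneg_mult fps_nonneg_qbinom)
  next
    case False
    then obtain s where t: "t = Suc s" and le: "r + s \<le> n"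
      by (cases t) auto
    let ?u = "Suc (r + s)"
    let ?e = "n + d - (r + s)"
    have b1: "qbinom (Suc n) ?u = qbinom n ?u + q ^ (n - (r + s)) * qbinom n (r + s)"
      by (rule qbinom_Suc_Suc')
    have b2: "qbinom (Suc n + d) ?u = qbinom (n + d) ?u + q ^ ?e * qbinom (n + d) (r + s)"
      using qbinom_Suc_Suc'[of "n + d" "r + s"] by simp
    have e1: "q ^ (t * d) * q ^ (n - (r + s)) = q ^ ?e * q ^ (s * d)"
      using le by (simp add: t flip: power_add)
    show ?thesis
    proof (cases r)
      case 0
      \<comment> \<open>Column 0 consists of ones, so only the other column is expanded.\<close>
      have "qbinom_minor (Suc n) d r t = qbinom_minor n d 0 t + q ^ ?e * qbinom_minor n d 0 s"
        using e1 b1 b2 unfolding qbinom_minor_def 0 t by (simp add: algebra_simps del: qbinom.simps(3))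
      then show ?thesis
        using Suc by (simp add: fps_nonneg_add fps_nonneg_mult)
    next
      case r: (Suc p)
      have b3: "qbinom (Suc n) r = qbinom n r + q ^ (n - p) * qbinom n p"
        unfolding r by (rule qbinom_Suc_Suc')
      have b4: "qbinom (Suc n + d) r = qbinom (n + d) r + q ^ (n + d - p) * qbinom (n + d) p"
        using qbinom_Suc_Suc'[of "n + d" p] by (simp add: r)
      have e2: "q ^ (t * d) * q ^ (n + d - p) = q ^ (n - p) * q ^ (Suc t * d)"
        using le by (simp add: r flip: power_add)
      have e3: "q ^ (n - (r + s)) * q ^ (n + d - p) = q ^ (n - p) * q ^ ?e"
        using le by (simp add: r flip: power_add)
      have u: "r + t = ?u" "r + s = p + t" "?u = p + Suc t"
        by (simp_all add: t r)
      have "qbinom_minor (Suc n) d r t = qbinom_minor n d r t + q ^ (n - p) * q ^ ?e * qbinom_minor n d p t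
          + q ^ ?e * qbinom_minor n d r s + q ^ (n - p) * qbinom_minor n d p (Suc t)"
      proof -
        have "qbinom_minor (Suc n) d r t = (qbinom n r + q ^ (n - p) * qbinom n p) * (qbinom (n + d) ?u + q ^ ?e * qbinom (n + d) (r + s))
           - q ^ (t * d) * (qbinom n ?u + q ^ (n - (r + s)) * qbinom n (r + s)) * (qbinom (n + d) r + q ^ (n + d - p) * qbinom (n + d) p)"
          unfolding qbinom_minor_def u(1) b1 b2 b3 b4 ..
        \<comment> \<open>The eight products are paired into four differences, which are minors
          times powers of \<open>q\<close> once \<open>e1\<close>, \<open>e2\<close>,
          \<open>e3\<close> adjust the exponents.\<close>
        also have "\<dots> = (qbinom n r * qbinom (n + d) ?u - q ^ (t * d) * qbinom n ?u * qbinom (n + d) r)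
           + (q ^ (n - p) * q ^ ?e * qbinom n p * qbinom (n + d) (r + s)
              - q ^ (t * d) * (q ^ (n - (r + s)) * q ^ (n + d - p)) * qbinom n (r + s) * qbinom (n + d) p)
           + (q ^ ?e * qbinom n r * qbinom (n + d) (r + s)
              - (q ^ (t * d) * q ^ (n - (r + s))) * qbinom n (r + s) * qbinom (n + d) r)
           + (q ^ (n - p) * qbinom n p * qbinom (n + d) ?u
              - (q ^ (t * d) * q ^ (n + d - p)) * qbinom n ?u * qbinom (n + d) p)"
          by (simp add: algebra_simps del: qbinom.simps(3))
        also have "\<dots> = qbinom_minor n d r t + q ^ (n - p) * q ^ ?e * qbinom_minor n d p t
          + q ^ ?e * qbinom_minor n d r s + q ^ (n - p) * qbinom_minor n d p (Suc t)"
        proof -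
          have p1: "qbinom n r * qbinom (n + d) ?u - q ^ (t * d) * qbinom n ?u * qbinom (n + d) r = qbinom_minor n d r t"
            by (simp only: qbinom_minor_def u(1))
          have p2: "q ^ (n - p) * q ^ ?e * qbinom n p * qbinom (n + d) (r + s)
              - q ^ (t * d) * (q ^ (n - (r + s)) * q ^ (n + d - p)) * qbinom n (r + s) * qbinom (n + d) p
              = q ^ (n - p) * q ^ ?e * qbinom_minor n d p t"
            unfolding e3 unfolding qbinom_minor_def u(2) by (simp add: algebra_simps del: qbinom.simps(3))
          have p3: "q ^ ?e * qbinom n r * qbinom (n + d) (r + s)
              - (q ^ (t * d) * q ^ (n - (r + s))) * qbinom n (r + s) * qbinom (n + d) r = q ^ ?e * qbinom_minor n d r s"
            unfolding e1 unfolding qbinom_minor_def by (simp add: algebra_simps del: qbinom.simps(3))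
          have p4: "q ^ (n - p) * qbinom n p * qbinom (n + d) ?u
              - (q ^ (t * d) * q ^ (n + d - p)) * qbinom n ?u * qbinom (n + d) p = q ^ (n - p) * qbinom_minor n d p (Suc t)"
            unfolding e2 unfolding qbinom_minor_def u(3) by (simp add: algebra_simps del: qbinom.simps(3))
          show ?thesis unfolding p1 p2 p3 p4 ..
        qed
        finally show ?thesis .
      qed
      then show ?thesis
        using Suc by (simp add: fps_nonneg_add fps_nonneg_mult)
    qed
  qed
qed

section \<open>Monotonicity of the diagonal sums\<close>

text \<open>
  The subtraction in \<open>a + r - 1\<close> is truncated only for \<open>a = r = 0\<close>, where \<open>qbinom 0 0 = 1\<close> is the correct value.
\<close>
definition box_sum :: "nat \<Rightarrow> nat \<Rightarrow> nat \<Rightarrow> int fps" where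
  "box_sum t a b = fps_suminf (\<lambda>r. q ^ ((t + 1) * r) * (qbinom (a + r - 1) r * qbinom (b + r - 1) (r + t)))"

text \<open>This is \<open>W\<^sub>t(a, b)\<close>. Raising \<open>t\<close> by one raises the
  exponent by \<open>2 * t + 1 + a\<close>, which absorbs the power of \<open>q\<close> in the last
  term of \<open>box_sum_Suc_Suc\<close>; the summand \<open>t * t\<close> makes high levels vanish
  in low degrees.\<close>

definition rect_sum :: "nat \<Rightarrow> nat \<Rightarrow> nat \<Rightarrow> int fps" where
  "rect_sum t a b = q ^ (a * b + t * a + t * t) * box_sum t a b"

text \<open>At \<open>t = 0\<close>, where \<open>rect_sum\<close> is symmetric, this is
  \<open>F\<^sub>m\<close> minus its successor. At higher levels the swapped arguments of the second
  diagonal let the recurrence pair \<open>rect_sum t a b\<close> with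
  \<open>rect_sum t b a\<close>.\<close>

definition diag_diff :: "nat \<Rightarrow> nat \<Rightarrow> int fps" where
  "diag_diff t m = fps_suminf (\<lambda>k. rect_sum t (Suc k) (Suc (k + m))) - fps_suminf (\<lambda>k. rect_sum t (Suc (Suc (k + m))) (Suc k))"

lemma box_sum_summable: "fps_summable (\<lambda>r. q ^ ((t + 1) * r) * f r)"
  by (rule fps_summable_X_power_mult) simp

text \<open>Summand by summand: the dual Pascal rule on the first Gaussian binomial splits off the
  term with \<open>a\<close>; in the rest, the defining rule on the second one either keeps the gap
  \<open>t\<close> between the lower indices or raises it to \<open>Suc t\<close>.\<close>

lemma box_sum_Suc_Suc:
  "box_sum t (Suc a) (Suc b) = box_sum t a (Suc b) + q ^ (Suc a + t) * box_sum t (Suc a) (Suc b)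
     + q ^ (2 * t + 2 + a) * box_sum (Suc t) (Suc a) (Suc b)"
proof -
  define \<tau> where "\<tau> t a b r = q ^ ((t + 1) * r) * (qbinom (a + r - 1) r * qbinom (b + r - 1) (r + t))"
    for t a b r
  have box_sum: "box_sum t a b = fps_suminf (\<tau> t a b)" for t a b
    unfolding box_sum_def \<tau>_def ..
  have S: "fps_summable (\<tau> t a b)" for t a b
    unfolding \<tau>_def by (rule box_sum_summable)
  have 0: "\<tau> t (Suc a) (Suc b) 0 = \<tau> t a (Suc b) 0"
    by (simp add: \<tau>_def)
  have rec: "\<tau> t (Suc a) (Suc b) (Suc r) = \<tau> t a (Suc b) (Suc r)
     + q ^ (Suc a + t) * \<tau> t (Suc a) (Suc b) r + q ^ (2 * t + 2 + a) * \<tau> (Suc t) (Suc a) (Suc b) r" for r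
  proof -
    have 1: "qbinom (Suc a + Suc r - 1) (Suc r) = qbinom (a + r) (Suc r) + q ^ a * qbinom (a + r) r"
      using qbinom_Suc_Suc'[of "a + r" r] by simp
    have 2: "qbinom (Suc b + Suc r - 1) (Suc r + t) = qbinom (b + r) (r + t) + q ^ Suc (r + t) * qbinom (b + r) (Suc (r + t))"
      by simp
    have "\<tau> t (Suc a) (Suc b) (Suc r) = \<tau> t a (Suc b) (Suc r)
        + q ^ ((t + 1) * Suc r) * q ^ a * (qbinom (a + r) r * qbinom (Suc b + Suc r - 1) (Suc r + t))"
      unfolding \<tau>_def 1 by (simp add: algebra_simps del: qbinom.simps(3))
    also have "q ^ ((t + 1) * Suc r) * q ^ a * (qbinom (a + r) r * qbinom (Suc b + Suc r - 1) (Suc r + t))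
       = q ^ ((t + 1) * Suc r + a) * (qbinom (a + r) r * qbinom (b + r) (r + t))
       + q ^ ((t + 1) * Suc r + a + Suc (r + t)) * (qbinom (a + r) r * qbinom (b + r) (Suc (r + t)))"
      unfolding 2 power_add by (simp add: algebra_simps del: qbinom.simps(3))
    also have "(t + 1) * Suc r + a = (Suc a + t) + (t + 1) * r"
      by simp
    also have "(Suc a + t) + (t + 1) * r + Suc (r + t) = (2 * t + 2 + a) + (Suc t + 1) * r"
      by simp
    finally show ?thesis
      by (simp only: \<tau>_def power_add power_Suc mult.assoc add.assoc diff_Suc_1 add_Suc add_Suc_right)
  qed
  have "box_sum t (Suc a) (Suc b) = \<tau> t a (Suc b) 0 + fps_suminf (\<lambda>r. \<tau> t a (Suc b) (Suc r)
     + q ^ (Suc a + t) * \<tau> t (Suc a) (Suc b) r + q ^ (2 * t + 2 + a) * \<tau> (Suc t) (Suc a) (Suc b) r)"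
    unfolding box_sum fps_suminf_Suc[OF S[of t "Suc a" "Suc b"]] 0 rec ..
  also have "\<dots> = (\<tau> t a (Suc b) 0 + fps_suminf (\<lambda>r. \<tau> t a (Suc b) (Suc r)))
     + q ^ (Suc a + t) * box_sum t (Suc a) (Suc b) + q ^ (2 * t + 2 + a) * box_sum (Suc t) (Suc a) (Suc b)"
    unfolding fps_suminf_add fps_suminf_mult[OF S] box_sum by (simp add: algebra_simps)
  also have "\<tau> t a (Suc b) 0 + fps_suminf (\<lambda>r. \<tau> t a (Suc b) (Suc r)) = box_sum t a (Suc b)"
    unfolding box_sum by (rule fps_suminf_Suc[OF S, symmetric])
  finally show ?thesis .
qed

lemma rect_sum_Suc_Suc:
  "rect_sum t (Suc a) (Suc b) = q ^ (Suc b + t) * rect_sum t a (Suc b) + q ^ (Suc a + t) * rect_sum t (Suc a) (Suc b)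
     + rect_sum (Suc t) (Suc a) (Suc b)"
proof -
  let ?e = "Suc a * Suc b + t * Suc a + t * t"
  have e1: "?e = (Suc b + t) + (a * Suc b + t * a + t * t)"
    by simp
  have e2: "?e + (2 * t + 2 + a) = Suc a * Suc b + Suc t * Suc a + Suc t * Suc t"
    by simp
  have "rect_sum t (Suc a) (Suc b) = q ^ ?e * box_sum t a (Suc b) + q ^ (Suc a + t) * rect_sum t (Suc a) (Suc b)
     + q ^ (?e + (2 * t + 2 + a)) * box_sum (Suc t) (Suc a) (Suc b)"
  proof -
    have "q ^ E * (x + q ^ u * y + q ^ v * z) = q ^ E * x + q ^ u * (q ^ E * y) + q ^ (E + v) * z"
      for E u v x y z
      by (simp add: algebra_simps power_add)
    then show ?thesis
      unfolding rect_sum_def by (subst box_sum_Suc_Suc)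
  qed
  also have "q ^ ?e * box_sum t a (Suc b) = q ^ (Suc b + t) * rect_sum t a (Suc b)"
    unfolding e1 rect_sum_def power_add by (simp add: mult.assoc)
  also have "q ^ (?e + (2 * t + 2 + a)) * box_sum (Suc t) (Suc a) (Suc b) = rect_sum (Suc t) (Suc a) (Suc b)"
    unfolding e2 rect_sum_def ..
  finally show ?thesis .
qed

lemma fps_nonneg_rect_sum: "fps_nonneg (rect_sum t a b)"
  unfolding rect_sum_def box_sum_def
  by (intro fps_nonneg_mult fps_nonneg_suminf fps_nonneg_qbinom fps_nonneg_X_power)

text \<open>Term by term in \<open>r\<close>, the difference is a twisted minor with rows
  \<open>a + r - 1\<close> and \<open>b + r - 1\<close>; the twist \<open>q ^ (t * (b - a))\<close>
  is the quotient of the two prefactors.\<close>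

lemma fps_nonneg_rect_sum_diff:
  assumes "0 < a" "a \<le> b"
  shows "fps_nonneg (rect_sum t a b - rect_sum t b a)"
proof -
  obtain c where c: "a = Suc c" using assms by (cases a) auto
  obtain d where d: "b = a + d" using assms le_Suc_ex by blast
  have e: "b * a + t * b + t * t = (a * b + t * a + t * t) + t * d"
    by (simp add: d algebra_simps)
  have "rect_sum t a b - rect_sum t b a = q ^ (a * b + t * a + t * t) * (box_sum t a b - q ^ (t * d) * box_sum t b a)"
    unfolding rect_sum_def e by (simp add: power_add algebra_simps)
  also have "box_sum t a b - q ^ (t * d) * box_sum t b a = fps_suminf (\<lambda>r. q ^ ((t + 1) * r) * qbinom_minor (c + r) d r t)"
  proof -
    have 1: "a + r - 1 = c + r" "b + r - 1 = c + r + d" for r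
      by (simp_all add: c d)
    show ?thesis
      unfolding box_sum_def fps_suminf_mult[OF box_sum_summable, symmetric] fps_suminf_diff[symmetric] 1 qbinom_minor_def
      by (simp add: algebra_simps)
  qed
  finally show ?thesis
    by (simp only: fps_nonneg_mult fps_nonneg_X_power fps_nonneg_suminf fps_nonneg_qbinom_minor)
qed

lemma rect_sum_summable:
  assumes "\<And>k. k \<le> a k * b k"
  shows "fps_summable (\<lambda>k. rect_sum t (a k) (b k))"
  unfolding rect_sum_def
  by (rule fps_summable_X_power_mult) (use assms in \<open>simp add: trans_le_add1\<close>)

text \<open>
  Expanding both diagonals by \<open>rect_sum_Suc_Suc\<close> and shifting the index of \<open>q\<^bsup>b + t\<^esup> W\<^sub>t(a - 1, b)\<close> in the first one,
  every \<open>W\<^sub>t(a, b)\<close> with \<open>a \<le> b\<close> from the first diagonal meets \<open>W\<^sub>t(b, a)\<close> from the second with the same power of \<open>q\<close>.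
\<close>
lemma diag_diff_rec:
  "diag_diff t m = q ^ (Suc m + t) * rect_sum t 0 (Suc m)
     + fps_suminf (\<lambda>k. q ^ (Suc k + t) * (rect_sum t (Suc k) (Suc (k + m)) - rect_sum t (Suc (k + m)) (Suc k)))
     + fps_suminf (\<lambda>k. q ^ (Suc (Suc (k + m)) + t) * (rect_sum t (Suc k) (Suc (Suc (k + m))) - rect_sum t (Suc (Suc (k + m))) (Suc k)))
     + diag_diff (Suc t) m"
proof -
  let ?f = "\<lambda>k. q ^ (Suc (k + m) + t) * rect_sum t k (Suc (k + m))"
  have sf: "fps_summable ?f"
    by (rule fps_summable_X_power_mult) simp
  have f: "fps_suminf ?f = q ^ (Suc m + t) * rect_sum t 0 (Suc m)
      + fps_suminf (\<lambda>k. q ^ (Suc (Suc (k + m)) + t) * rect_sum t (Suc k) (Suc (Suc (k + m))))"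
    using fps_suminf_Suc[OF sf] by simp
  have A: "fps_suminf (\<lambda>k. rect_sum t (Suc k) (Suc (k + m))) = fps_suminf ?f
      + fps_suminf (\<lambda>k. q ^ (Suc k + t) * rect_sum t (Suc k) (Suc (k + m)))
      + fps_suminf (\<lambda>k. rect_sum (Suc t) (Suc k) (Suc (k + m)))"
    unfolding fps_suminf_add[symmetric] by (subst rect_sum_Suc_Suc) simp
  have B: "fps_suminf (\<lambda>k. rect_sum t (Suc (Suc (k + m))) (Suc k)) =
        fps_suminf (\<lambda>k. q ^ (Suc k + t) * rect_sum t (Suc (k + m)) (Suc k))
      + fps_suminf (\<lambda>k. q ^ (Suc (Suc (k + m)) + t) * rect_sum t (Suc (Suc (k + m))) (Suc k))
      + fps_suminf (\<lambda>k. rect_sum (Suc t) (Suc (Suc (k + m))) (Suc k))"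
    unfolding fps_suminf_add[symmetric] by (subst rect_sum_Suc_Suc) simp
  show ?thesis
    unfolding diag_diff_def A B f right_diff_distrib fps_suminf_diff by simp
qed

lemma diag_diff_nth_eq_0:
  assumes "n < t"
  shows "diag_diff t m $ n = 0"
proof -
  have "rect_sum t a b $ n = 0" for a b
  proof -
    have "t \<le> t * t" by simp
    then have "n < a * b + t * a + t * t" using assms by linarith
    then show ?thesis by (simp add: rect_sum_def fps_X_power_mult_nth)
  qed
  then show ?thesis by (simp add: diag_diff_def fps_suminf_def)
qed

text \<open>For a fixed coefficient \<open>n\<close> this is a descent from levels
  \<open>t > n\<close>, where the coefficient is zero; by \<open>diag_diff_rec\<close>, each step to
  a smaller \<open>t\<close> adds a nonnegative series.\<close>

lemma fps_nonneg_diag_diff: "fps_nonneg (diag_diff t m)"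
  unfolding fps_nonneg_def
proof
  fix n
  \<comment> \<open>\<open>j\<close> bounds the number of levels left before \<open>t\<close>
    exceeds \<open>n\<close>.\<close>
  have "0 \<le> diag_diff t m $ n" if "n < t + j" for j
    using that
  proof (induction j arbitrary: t)
    case 0
    then show ?case by (simp add: diag_diff_nth_eq_0)
  next
    case (Suc j)
    have "0 \<le> diag_diff (Suc t) m $ n"
      using Suc by simp
    moreover have "fps_nonneg (diag_diff t m - diag_diff (Suc t) m)"
      by (subst diag_diff_rec)
        (simp add: fps_nonneg_add fps_nonneg_mult fps_nonneg_suminf fps_nonneg_rect_sum fps_nonneg_rect_sum_diff
          del: power_Suc)
    ultimately show ?case
      by (auto simp: fps_nonneg_def dest: spec[of _ n])
  qed
  from this[of "Suc n"] show "0 \<le> diag_diff t m $ n" by simp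
qed

section \<open>Second differences of the diagonal sums\<close>

definition hsym :: "nat \<Rightarrow> nat \<Rightarrow> int fps" where
  "hsym r a = qbinom (a + r - 1) r"

text \<open>\<open>hsym r a\<close> is the complete homogeneous symmetric polynomial of degree
  \<open>r\<close> in \<open>1, q, ..., q ^ (a - 1)\<close>. The two rules ask whether a multiset
  from \<open>{0..a}\<close> contains \<open>a\<close>, respectively \<open>0\<close>.\<close>

lemma hsym_0 [simp]: "hsym 0 a = 1"
  and hsym_Suc_0 [simp]: "hsym (Suc r) 0 = 0"
  and hsym_Suc_Suc: "hsym (Suc r) (Suc a) = hsym (Suc r) a + q ^ a * hsym r (Suc a)"
  and hsym_Suc_Suc': "hsym (Suc r) (Suc a) = hsym r (Suc a) + q ^ Suc r * hsym (Suc r) a"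
  using qbinom_Suc_Suc'[of "a + r" r] by (simp_all add: hsym_def qbinom_eq_0)

text \<open>For \<open>r > 0\<close>, eliminate \<open>hsym (r - 1) (Suc a)\<close> between the two
  rules.\<close>

lemma hsym_ratio: "(1 - q ^ a) * hsym r (Suc a) = (1 - q ^ (a + r)) * hsym r a"
proof (cases r)
  case (Suc p)
  have 1: "hsym r (Suc a) = hsym r a + q ^ a * hsym p (Suc a)"
    and 2: "hsym r (Suc a) = hsym p (Suc a) + q ^ r * hsym r a"
    unfolding Suc by (rule hsym_Suc_Suc hsym_Suc_Suc')+
  have "hsym r (Suc a) = hsym r a + q ^ a * (hsym r (Suc a) - q ^ r * hsym r a)"
    using 1 2 by (metis add_diff_cancel_right')
  then show ?thesis
    by (simp add: algebra_simps power_add)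
qed simp

text \<open>\<open>s = 1\<close> gives the sum in \<open>X(a, b)\<close>, \<open>s = 2\<close> the
  one in the rank series.\<close>

definition pair_sum :: "nat \<Rightarrow> nat \<Rightarrow> nat \<Rightarrow> int fps" where
  "pair_sum s a b = fps_suminf (\<lambda>r. q ^ (s * r) * (hsym r a * hsym r b))"

text \<open>\<open>inv_qfact k\<close> is \<open>1/(q)\<^sub>k\<close>, obtained as the coefficientwise limit of \<open>hsym r (k + 1)\<close> for \<open>r \<rightarrow> \<infinity>\<close>.\<close>
definition inv_qfact :: "nat \<Rightarrow> int fps" where
  "inv_qfact k = Abs_fps (\<lambda>n. hsym n (Suc k) $ n)"

lemma pair_sum_summable: "0 < s \<Longrightarrow> fps_summable (\<lambda>r. q ^ (s * r) * f r)"
  by (rule fps_summable_X_power_mult) simp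

lemma pair_sum_commute: "pair_sum s a b = pair_sum s b a"
  by (simp add: pair_sum_def mult.commute)

lemma pair_sum_0: "0 < s \<Longrightarrow> pair_sum s 0 b = 1"
  unfolding pair_sum_def by (subst fps_suminf_Suc[OF pair_sum_summable]) (auto simp: fps_suminf_def fps_eq_iff)

text \<open>By \<open>hsym_Suc_Suc'\<close>, passing from \<open>r\<close> to \<open>Suc r\<close>
  changes \<open>hsym r (Suc k)\<close> only by a multiple of \<open>q ^ Suc r\<close>.\<close>

lemma hsym_nth_eq_inv_qfact:
  assumes "n \<le> r"
  shows "hsym r (Suc k) $ n = inv_qfact k $ n"
  using assms
proof (induction r rule: dec_induct)
  case (step r)
  then show ?case
    by (simp add: hsym_Suc_Suc' fps_X_power_mult_nth del: power_Suc)
qed (simp add: inv_qfact_def)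

lemma inv_qfact_0 [simp]: "inv_qfact 0 = 1"
proof (rule fps_ext)
  fix n
  have "hsym r 1 = 1" for r
    by (induction r) (simp_all add: hsym_Suc_Suc)
  then show "inv_qfact 0 $ n = 1 $ n"
    by (simp add: inv_qfact_def)
qed

text \<open>The limit of \<open>hsym_Suc_Suc\<close>; with \<open>inv_qfact_0\<close> it
  characterises the reciprocal of \<open>(1 - q)...(1 - q ^ k)\<close>.\<close>

lemma inv_qfact_Suc: "inv_qfact (Suc k) = inv_qfact k + q ^ Suc k * inv_qfact (Suc k)"
proof (rule fps_ext)
  fix n
  have "inv_qfact (Suc k) $ n = hsym (Suc n) (Suc (Suc k)) $ n"
    by (simp add: hsym_nth_eq_inv_qfact)
  also have "\<dots> = (hsym (Suc n) (Suc k) + q ^ Suc k * hsym n (Suc (Suc k))) $ n"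
    by (simp only: hsym_Suc_Suc)
  also have "\<dots> = (inv_qfact k + q ^ Suc k * inv_qfact (Suc k)) $ n"
    by (simp add: hsym_nth_eq_inv_qfact fps_X_power_mult_nth del: power_Suc)
  finally show "inv_qfact (Suc k) $ n = (inv_qfact k + q ^ Suc k * inv_qfact (Suc k)) $ n" .
qed

text \<open>Telescoping: by \<open>hsym_Suc_Suc'\<close>, the summand for \<open>r > 0\<close> is
  the increment of \<open>hsym r (Suc a) * hsym r (Suc b)\<close> from \<open>r - 1\<close> to
  \<open>r\<close>, and these products converge to the right-hand side.\<close>

lemma pair_sum_inv_qfact: "pair_sum 1 a (Suc b) + pair_sum 1 (Suc a) b - pair_sum 2 a b = inv_qfact a * inv_qfact b"
proof (rule fps_ext)
  fix n
  let ?f = "\<lambda>r. q ^ r * (hsym r a * hsym r (Suc b)) + q ^ r * (hsym r (Suc a) * hsym r b) - q ^ (2 * r) * (hsym r a * hsym r b)"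
  have "pair_sum 1 a (Suc b) + pair_sum 1 (Suc a) b - pair_sum 2 a b = fps_suminf ?f"
    by (simp add: pair_sum_def fps_suminf_add fps_suminf_diff)
  then have "(pair_sum 1 a (Suc b) + pair_sum 1 (Suc a) b - pair_sum 2 a b) $ n = (\<Sum>r\<le>n. ?f r) $ n"
    by (simp add: fps_suminf_def fps_sum_nth)
  also have "(\<Sum>r\<le>m. ?f r) = hsym m (Suc a) * hsym m (Suc b)" for m
  proof (induction m)
    case (Suc m)
    define p x y where "p = q ^ Suc m" and "x = hsym m (Suc a)" and "y = hsym m (Suc b)"
    have *: "hsym (Suc m) (Suc a) = x + p * hsym (Suc m) a" "hsym (Suc m) (Suc b) = y + p * hsym (Suc m) b"
      unfolding p_def x_def y_def by (rule hsym_Suc_Suc')+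
    have "?f (Suc m) = p * (hsym (Suc m) a * hsym (Suc m) (Suc b))
        + p * (hsym (Suc m) (Suc a) * hsym (Suc m) b) - p * p * (hsym (Suc m) a * hsym (Suc m) b)"
      by (simp add: p_def mult_2 power_add)
    then show ?case
      unfolding sum.atMost_Suc Suc.IH * by (simp add: algebra_simps flip: x_def y_def)
  qed simp
  also have "(hsym n (Suc a) * hsym n (Suc b)) $ n = (inv_qfact a * inv_qfact b) $ n"
    by (simp add: fps_mult_nth hsym_nth_eq_inv_qfact)
  finally show "(pair_sum 1 a (Suc b) + pair_sum 1 (Suc a) b - pair_sum 2 a b) $ n = (inv_qfact a * inv_qfact b) $ n" .
qed

text \<open>Apply \<open>hsym_ratio\<close> in each summand; its factor \<open>q ^ (a + r)\<close>
  turns the weight \<open>q ^ r\<close> into \<open>q ^ (2 * r)\<close>, which is how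
  \<open>pair_sum 2\<close> arises.\<close>

lemma pair_sum_Suc: "(1 - q ^ a) * pair_sum 1 (Suc a) b = pair_sum 1 a b - q ^ a * pair_sum 2 a b"
proof -
  have s: "fps_summable (\<lambda>r. q ^ r * f r)" "fps_summable (\<lambda>r. q ^ (2 * r) * f r)" for f
    by (rule fps_summable_X_power_mult; simp)+
  have "(1 - q ^ a) * (q ^ r * (hsym r (Suc a) * hsym r b)) =
      q ^ r * (hsym r a * hsym r b) - q ^ a * (q ^ (2 * r) * (hsym r a * hsym r b))" for r
  proof -
    have "(1 - q ^ a) * (q ^ r * (hsym r (Suc a) * hsym r b)) = q ^ r * hsym r b * ((1 - q ^ a) * hsym r (Suc a))"
      by (simp add: algebra_simps)
    also have "\<dots> = q ^ r * (hsym r a * hsym r b) - q ^ a * (q ^ (2 * r) * (hsym r a * hsym r b))"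
      unfolding hsym_ratio mult_2 power_add by (simp add: algebra_simps)
    finally show ?thesis .
  qed
  then show ?thesis
    by (simp add: pair_sum_def fps_suminf_mult[OF s(1), symmetric] fps_suminf_mult[OF s(2), symmetric]
        fps_suminf_diff[symmetric])
qed

text \<open>Add the contiguity relations in \<open>a\<close> and in \<open>b\<close> and insert the
  telescoped identity. The coefficients \<open>q ^ a\<close> and \<open>q ^ b\<close> come from
  shifting \<open>b\<close> or \<open>a\<close> in the prefactor \<open>q ^ (a * b)\<close>.\<close>

lemma pair_sum_second_difference:
  "2 * pair_sum 1 a b - q ^ a * pair_sum 1 a (Suc b) - q ^ b * pair_sum 1 (Suc a) b =
     pair_sum 2 a b + (1 - q ^ a - q ^ b) * (inv_qfact a * inv_qfact b)"
proof -
  have "(1 - q ^ a) * pair_sum 1 (Suc a) b = pair_sum 1 a b - q ^ a * pair_sum 2 a b"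
    and "(1 - q ^ b) * pair_sum 1 a (Suc b) = pair_sum 1 a b - q ^ b * pair_sum 2 a b"
    using pair_sum_Suc[of a b] pair_sum_Suc[of b a] by (simp_all add: pair_sum_commute)
  then have "2 * pair_sum 1 a b = ((1 - q ^ a) * pair_sum 1 (Suc a) b + q ^ a * pair_sum 2 a b)
      + ((1 - q ^ b) * pair_sum 1 a (Suc b) + q ^ b * pair_sum 2 a b)"
    by simp
  then show ?thesis
    unfolding pair_sum_inv_qfact[symmetric] by (simp add: algebra_simps)
qed

section \<open>Rank and crank series as second differences\<close>

definition diag_sum :: "nat \<Rightarrow> int fps" where
  "diag_sum m = fps_suminf (\<lambda>k. rect_sum 0 (Suc k) (Suc (k + m)))"

definition rank_gen_fun :: "nat \<Rightarrow> int fps" where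
  "rank_gen_fun c = (if c = 0 then 1 else 0)
     + fps_suminf (\<lambda>k. q ^ (Suc k * Suc (k + c)) * pair_sum 2 (Suc k) (Suc (k + c)))"

text \<open>With \<open>a = k + 1\<close> and \<open>b = k + c + 1\<close> the exponent is
  \<open>a * b - 1\<close>, written without subtraction.\<close>

definition crank_gen_fun :: "nat \<Rightarrow> int fps" where
  "crank_gen_fun c = (1 - q) * fps_suminf (\<lambda>k. q ^ (k * Suc (k + c) + k + c) * (inv_qfact k * inv_qfact (k + c)))"

lemma rect_sum_0: "rect_sum 0 a b = q ^ (a * b) * pair_sum 1 a b"
  by (simp add: rect_sum_def box_sum_def pair_sum_def hsym_def)

lemma rect_sum_0_commute: "rect_sum 0 a b = rect_sum 0 b a"
  by (simp add: rect_sum_0 pair_sum_commute mult.commute)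

lemma diag_diff_0: "diag_diff 0 m = diag_sum m - diag_sum (Suc m)"
  by (simp add: diag_diff_def diag_sum_def rect_sum_0_commute[of "Suc (Suc _)"])

lemma rect_sum_0_second_difference:
  "2 * rect_sum 0 (Suc i) (Suc j) - rect_sum 0 (Suc i) (Suc (Suc j)) - rect_sum 0 (Suc (Suc i)) (Suc j) =
     q ^ (Suc i * Suc j) * pair_sum 2 (Suc i) (Suc j) + q ^ (Suc i * Suc j) * (inv_qfact i * inv_qfact j)
     - q ^ (Suc i * Suc j + Suc i + Suc j) * (inv_qfact (Suc i) * inv_qfact (Suc j))"
proof -
  define a b where "a = Suc i" and "b = Suc j"
  have "inv_qfact i = (1 - q ^ a) * inv_qfact a" "inv_qfact j = (1 - q ^ b) * inv_qfact b"
    using inv_qfact_Suc[of i] inv_qfact_Suc[of j] by (simp_all add: a_def b_def algebra_simps del: power_Suc)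
  then have Z: "inv_qfact i * inv_qfact j = (1 - q ^ a) * (1 - q ^ b) * (inv_qfact a * inv_qfact b)"
    by simp
  have "2 * rect_sum 0 a b - rect_sum 0 a (Suc b) - rect_sum 0 (Suc a) b =
      q ^ (a * b) * (2 * pair_sum 1 a b - q ^ a * pair_sum 1 a (Suc b) - q ^ b * pair_sum 1 (Suc a) b)"
    by (simp add: rect_sum_0 power_add algebra_simps)
  also have "\<dots> = q ^ (a * b) * pair_sum 2 a b + q ^ (a * b) * (inv_qfact i * inv_qfact j) - q ^ (a * b + a + b) * (inv_qfact a * inv_qfact b)"
    unfolding pair_sum_second_difference Z by (simp add: algebra_simps power_add)
  finally show ?thesis
    by (simp only: a_def b_def)
qed

lemma diag_sum_second_difference:
  "rank_gen_fun c - crank_gen_fun c = (if c = 0 then 2 * (diag_sum 0 - diag_sum 1) else 2 * diag_sum c - diag_sum (c + 1) - diag_sum (c - 1))"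
proof -
  let ?E = "\<lambda>k. q ^ (k * Suc (k + c) + k + c) * (inv_qfact k * inv_qfact (k + c))"
  let ?U = "\<lambda>k. q ^ (Suc k * Suc (k + c)) * pair_sum 2 (Suc k) (Suc (k + c))"
  have sE: "fps_summable ?E"
    by (rule fps_summable_X_power_mult) simp
  have "2 * rect_sum 0 (Suc k) (Suc (k + c)) - rect_sum 0 (Suc k) (Suc (k + Suc c)) - rect_sum 0 (Suc (Suc k)) (Suc (k + c))
      = ?U k + q * ?E k - ?E (Suc k)" for k
    using rect_sum_0_second_difference[of k "k + c"]
    by (simp add: algebra_simps)
  then have "fps_suminf (\<lambda>k. 2 * rect_sum 0 (Suc k) (Suc (k + c)) - rect_sum 0 (Suc k) (Suc (k + Suc c))
      - rect_sum 0 (Suc (Suc k)) (Suc (k + c))) = fps_suminf (\<lambda>k. ?U k + q * ?E k - ?E (Suc k))"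
    by simp
  moreover have "fps_suminf (\<lambda>k. 2 * rect_sum 0 (Suc k) (Suc (k + c)) - rect_sum 0 (Suc k) (Suc (k + Suc c))
      - rect_sum 0 (Suc (Suc k)) (Suc (k + c)))
      = 2 * diag_sum c - diag_sum (Suc c) - fps_suminf (\<lambda>k. rect_sum 0 (Suc (Suc k)) (Suc (k + c)))"
    unfolding fps_suminf_diff diag_sum_def by (subst fps_suminf_mult[OF rect_sum_summable]) auto
  \<comment> \<open>The index shift of \<open>?E\<close> leaves \<open>-(1 - q)\<close> times its
    sum, plus its first term \<open>?E 0\<close>.\<close>
  moreover have "fps_suminf (\<lambda>k. ?U k + q * ?E k - ?E (Suc k))
      = fps_suminf ?U - crank_gen_fun c + q ^ c * inv_qfact c"
    unfolding fps_suminf_diff fps_suminf_add fps_suminf_mult[OF sE] crank_gen_fun_def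
    using fps_suminf_Suc[OF sE] by (simp add: algebra_simps)
  ultimately have *: "2 * diag_sum c - diag_sum (Suc c) - fps_suminf (\<lambda>k. rect_sum 0 (Suc (Suc k)) (Suc (k + c)))
      = fps_suminf ?U - crank_gen_fun c + q ^ c * inv_qfact c"
    by simp
  \<comment> \<open>The boundary term \<open>q ^ c * inv_qfact c\<close> is the isolated
    \<open>1\<close> of the rank series if \<open>c = 0\<close>; otherwise it is the first term of
    \<open>diag_sum (c - 1)\<close>, which the third diagonal lacks.\<close>
  show ?thesis
  proof (cases c)
    case 0
    have "fps_suminf (\<lambda>k. rect_sum 0 (Suc (Suc k)) (Suc (k + c))) = diag_sum 1"
      by (simp add: diag_sum_def 0 rect_sum_0_commute[of "Suc (Suc _)"])
    then show ?thesis
      using * by (simp add: rank_gen_fun_def 0 algebra_simps)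
  next
    case (Suc d)
    have "diag_sum d = rect_sum 0 1 c + fps_suminf (\<lambda>k. rect_sum 0 (Suc (Suc k)) (Suc (k + c)))"
      unfolding diag_sum_def by (subst fps_suminf_Suc[OF rect_sum_summable]) (auto simp: Suc)
    \<comment> \<open>In \<open>pair_sum_inv_qfact\<close> at \<open>a = 0\<close>, the values
      \<open>pair_sum 1 0 (Suc c)\<close> and \<open>pair_sum 2 0 c\<close> are both 1 and
      cancel.\<close>
    moreover have "rect_sum 0 1 c = q ^ c * inv_qfact c"
      using pair_sum_inv_qfact[of 0 c] by (simp add: rect_sum_0 pair_sum_0)
    ultimately show ?thesis
      using * by (simp add: rank_gen_fun_def Suc algebra_simps)
  qed
qed

text \<open>Summed second differences leave a first difference; the reflected case
  \<open>c = 0\<close> supplies the starting value.\<close>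

lemma sum_rank_minus_crank:
  "(rank_gen_fun 0 - crank_gen_fun 0) + 2 * (\<Sum>c=1..m. rank_gen_fun c - crank_gen_fun c) = 2 * diag_diff 0 m"
proof (induction m)
  case 0
  then show ?case by (simp add: diag_sum_second_difference diag_diff_0)
next
  case (Suc m)
  have "(rank_gen_fun 0 - crank_gen_fun 0) + 2 * (\<Sum>c=1..Suc m. rank_gen_fun c - crank_gen_fun c)
      = 2 * diag_diff 0 m + 2 * (rank_gen_fun (Suc m) - crank_gen_fun (Suc m))"
    using Suc by (simp add: algebra_simps)
  also have "\<dots> = 2 * diag_diff 0 (Suc m)"
    unfolding diag_diff_0 by (simp add: diag_sum_second_difference algebra_simps)
  finally show ?case .
qed

section \<open>Generating functions of partitions by rank and crank\<close>

text \<open>Induction on \<open>n\<close> by the dual Pascal rule. Where \<open>m + i - k\<close> is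
  truncated, \<open>qbinom m (k - i)\<close> vanishes.\<close>

lemma qbinom_vandermonde:
  "qbinom (m + n) k = (\<Sum>i\<le>k. q ^ (i * (m + i - k)) * (qbinom m (k - i) * qbinom n i))"
proof (induction n arbitrary: k)
  case 0
  have "(\<Sum>i\<le>k. q ^ (i * (m + i - k)) * (qbinom m (k - i) * qbinom 0 i)) =
      (\<Sum>i\<in>{0}. q ^ (i * (m + i - k)) * (qbinom m (k - i) * qbinom 0 i))"
    by (rule sum.mono_neutral_right) (auto simp: qbinom_eq_0)
  then show ?case by simp
next
  case (Suc n)
  show ?case
  proof (cases k)
    case k: (Suc p)
    let ?f = "\<lambda>n i. q ^ (i * (m + i - k)) * (qbinom m (k - i) * qbinom n i)"
    let ?g = "\<lambda>i. q ^ (i * (m + i - p)) * (qbinom m (p - i) * qbinom n i)"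
    have f0: "?f (Suc n) 0 = ?f n 0"
      by simp
    have f: "?f (Suc n) (Suc i) = ?f n (Suc i) + q ^ (m + n - p) * ?g i" if "i \<le> p" for i
    proof -
      \<comment> \<open>The exponents need to agree only where neither Gaussian binomial vanishes;
        elsewhere both sides are zero.\<close>
      have "q ^ (Suc i * (m + Suc i - k)) * q ^ (n - i) * (qbinom m (p - i) * qbinom n i)
          = q ^ (m + n - p) * q ^ (i * (m + i - p)) * (qbinom m (p - i) * qbinom n i)"
      proof (cases "m < p - i \<or> n < i")
        case True
        then show ?thesis by (auto simp: qbinom_eq_0)
      next
        case False
        then have "(m + i - p) + (n - i) = m + n - p"
          using that by linarith
        moreover have "Suc i * (m + Suc i - k) = (m + i - p) + i * (m + i - p)"
          by (simp add: k)
        ultimately have "Suc i * (m + Suc i - k) + (n - i) = m + n - p + i * (m + i - p)"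
          by linarith
        then show ?thesis
          by (simp flip: power_add)
      qed
      moreover have "qbinom (Suc n) (Suc i) = qbinom n (Suc i) + q ^ (n - i) * qbinom n i"
        by (rule qbinom_Suc_Suc')
      ultimately show ?thesis
        by (simp add: k algebra_simps del: qbinom.simps(3))
    qed
    have "(\<Sum>i\<le>k. ?f (Suc n) i) = ?f n 0 + (\<Sum>i\<le>p. ?f (Suc n) (Suc i))"
      unfolding k by (subst sum.atMost_Suc_shift) simp
    also have "\<dots> = ?f n 0 + (\<Sum>i\<le>p. ?f n (Suc i) + q ^ (m + n - p) * ?g i)"
      using f by (metis (no_types, lifting) atMost_iff sum.cong)
    also have "\<dots> = (\<Sum>i\<le>k. ?f n i) + q ^ (m + n - p) * (\<Sum>i\<le>p. ?g i)"
      unfolding sum.distrib sum_distrib_left[symmetric] k by (subst sum.atMost_Suc_shift) simp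
    also have "\<dots> = qbinom (m + n) (Suc p) + q ^ (m + n - p) * qbinom (m + n) p"
      using Suc[of k] Suc[of p] k by simp
    also have "\<dots> = qbinom (m + Suc n) k"
      unfolding k add_Suc_right by (rule qbinom_Suc_Suc'[symmetric])
    finally show ?thesis ..
  qed simp
qed

text \<open>In the square \<open>{..n} \<times> {..n}\<close>, index pairs outside the triangle
  \<open>i + r \<le> n\<close> do not contribute to coefficient \<open>n\<close>.\<close>

lemma fps_suminf_triangle:
  assumes "\<And>i r n. n < i + r \<Longrightarrow> f i r $ n = 0"
  shows "fps_suminf (\<lambda>j. \<Sum>i\<le>j. f i (j - i)) = fps_suminf (\<lambda>i. fps_suminf (f i))"
proof (rule fps_ext)
  fix n
  have "(\<Sum>j\<le>n. \<Sum>i\<le>j. f i (j - i) $ n) = (\<Sum>(i, r)\<in>{(i, r). i + r \<le> n}. f i r $ n)"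
    by (rule sum.triangle_reindex_eq[symmetric])
  also have "\<dots> = (\<Sum>(i, r)\<in>{..n} \<times> {..n}. f i r $ n)"
  proof (rule sum.mono_neutral_left)
    show "\<forall>p\<in>{..n} \<times> {..n} - {(i, r). i + r \<le> n}. (case p of (i, r) \<Rightarrow> f i r $ n) = 0"
    proof
      fix p assume p: "p \<in> {..n} \<times> {..n} - {(i, r). i + r \<le> n}"
      obtain i r where ir: "p = (i, r)" by (cases p)
      then have "n < i + r" using p by simp
      then show "(case p of (i, r) \<Rightarrow> f i r $ n) = 0"
        unfolding ir by (simp add: assms)
    qed
  qed auto
  finally show "fps_suminf (\<lambda>j. \<Sum>i\<le>j. f i (j - i)) $ n = fps_suminf (\<lambda>i. fps_suminf (f i)) $ n"
    by (simp add: fps_suminf_def fps_sum_nth sum.cartesian_product)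
qed

text \<open>Collected along \<open>i + r = j\<close>, with \<open>a = i + 1\<close>, the inner sum
  is the q-Vandermonde expansion of \<open>qbinom ((j + c) + j) j\<close>. The result is indexed by
  first hooks of size \<open>2 * j + 1 + c\<close>.\<close>

lemma rank_gen_fun_hooks:
  "rank_gen_fun c = (if c = 0 then 1 else 0) + fps_suminf (\<lambda>j. q ^ (2 * j + 1 + c) * qbinom (2 * j + c) j)"
proof -
  define f where "f i r = q ^ (Suc i * Suc (i + c)) * (q ^ (2 * r) * (hsym r (Suc i) * hsym r (Suc (i + c))))" for i r
  have "fps_suminf (f i) = q ^ (Suc i * Suc (i + c)) * pair_sum 2 (Suc i) (Suc (i + c))" for i
    unfolding f_def pair_sum_def by (rule fps_suminf_mult[OF pair_sum_summable]) simp
  moreover have "fps_suminf (\<lambda>j. \<Sum>i\<le>j. f i (j - i)) = fps_suminf (\<lambda>i. fps_suminf (f i))"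
  proof (rule fps_suminf_triangle)
    fix i r n :: nat assume "n < i + r"
    have "f i r = q ^ (Suc i * Suc (i + c) + 2 * r) * (hsym r (Suc i) * hsym r (Suc (i + c)))"
      by (simp only: f_def power_add mult.assoc)
    then show "f i r $ n = 0"
      using \<open>n < i + r\<close> by (simp add: fps_X_power_mult_nth del: power_Suc)
  qed
  moreover have "(\<Sum>i\<le>j. f i (j - i)) = q ^ (2 * j + 1 + c) * qbinom (2 * j + c) j" for j
  proof -
    have "f i (j - i) = q ^ (2 * j + 1 + c) * (q ^ (i * (j + c + i - j)) * (qbinom (j + c) (j - i) * qbinom j i))"
      if le: "i \<le> j" for i
    proof -
      obtain r where r: "j = i + r" using le_Suc_ex[OF le] by blast
      have hs: "hsym (j - i) (Suc i) = qbinom j i" "hsym (j - i) (Suc (i + c)) = qbinom (j + c) (j - i)"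
        using qbinom_sym[of i r] by (simp_all add: hsym_def r add_ac)
      have ex: "Suc i * Suc (i + c) + 2 * (j - i) = (2 * j + 1 + c) + i * (j + c + i - j)"
        by (simp add: r)
      have "f i (j - i) = q ^ (Suc i * Suc (i + c) + 2 * (j - i)) * (qbinom j i * qbinom (j + c) (j - i))"
        by (simp only: f_def power_add mult.assoc hs)
      also have "\<dots> = q ^ (2 * j + 1 + c) * (q ^ (i * (j + c + i - j)) * (qbinom j i * qbinom (j + c) (j - i)))"
        unfolding ex by (simp only: power_add[of _ "2 * j + 1 + c"] mult.assoc)
      finally show ?thesis
        by (simp only: mult.commute[of "qbinom j i"])
    qed
    then have "(\<Sum>i\<le>j. f i (j - i)) = q ^ (2 * j + 1 + c) * qbinom (j + c + j) j"
      unfolding qbinom_vandermonde sum_distrib_left by (intro sum.cong) auto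
    also have "j + c + j = 2 * j + c"
      by simp
    finally show ?thesis .
  qed
  ultimately show ?thesis
    by (simp add: rank_gen_fun_def)
qed

section \<open>Generating functions of weighted sets\<close>

definition gen_fun :: "('a \<Rightarrow> nat) \<Rightarrow> 'a set \<Rightarrow> int fps" where
  "gen_fun w S = Abs_fps (\<lambda>n. int (card {x \<in> S. w x = n}))"

text \<open>Needed since \<open>card\<close> is \<open>0\<close> on infinite sets.\<close>
definition fin_levels :: "('a \<Rightarrow> nat) \<Rightarrow> 'a set \<Rightarrow> bool" where
  "fin_levels w S \<longleftrightarrow> (\<forall>n. finite {x \<in> S. w x = n})"

lemma gen_fun_empty [simp]: "gen_fun w {} = 0"
  by (simp add: gen_fun_def fps_eq_iff)

lemma gen_fun_singleton: "gen_fun w {x} = q ^ w x"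
proof (rule fps_ext)
  fix n
  have "{y \<in> {x}. w y = n} = (if n = w x then {x} else {})"
    by auto
  then show "gen_fun w {x} $ n = q ^ w x $ n"
    by (simp add: gen_fun_def fps_X_power_nth)
qed

lemma fin_levels_subset: "fin_levels w B \<Longrightarrow> S \<subseteq> B \<Longrightarrow> fin_levels w S"
  unfolding fin_levels_def
proof
  fix n
  assume "\<forall>n. finite {x \<in> B. w x = n}" "S \<subseteq> B"
  then show "finite {x \<in> S. w x = n}"
    by (intro finite_subset[of "{x \<in> S. w x = n}" "{x \<in> B. w x = n}"]) auto
qed

lemma gen_fun_Un:
  assumes "fin_levels w S" "S = A \<union> B" "A \<inter> B = {}"
  shows "gen_fun w S = gen_fun w A + gen_fun w B"
proof (rule fps_ext)
  fix n
  have S: "{x \<in> S. w x = n} = {x \<in> A. w x = n} \<union> {x \<in> B. w x = n}"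
    using assms by auto
  moreover have "finite {x \<in> S. w x = n}"
    using assms by (simp add: fin_levels_def)
  ultimately have "card {x \<in> S. w x = n} = card {x \<in> A. w x = n} + card {x \<in> B. w x = n}"
    using assms(3) by (auto intro!: card_Un_disjoint)
  then show "gen_fun w S $ n = (gen_fun w A + gen_fun w B) $ n"
    by (simp add: gen_fun_def)
qed

lemma gen_fun_image:
  assumes "inj_on f S" "\<And>x. x \<in> S \<Longrightarrow> v (f x) = w x + c"
  shows "gen_fun v (f ` S) = q ^ c * gen_fun w S"
proof (rule fps_ext)
  fix n
  have "{y \<in> f ` S. v y = n} = f ` {x \<in> S. w x + c = n}"
    using assms(2) by auto
  moreover have "card (f ` {x \<in> S. w x + c = n}) = card {x \<in> S. w x + c = n}"
    by (rule card_image) (use assms(1) in \<open>auto simp: inj_on_def\<close>)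
  moreover have "{x \<in> S. w x + c = n} = (if n < c then {} else {x \<in> S. w x = n - c})"
    by auto
  ultimately show "gen_fun v (f ` S) $ n = (q ^ c * gen_fun w S) $ n"
    by (simp add: gen_fun_def fps_X_power_mult_nth)
qed

lemma gen_fun_Times:
  assumes "fin_levels w A" "fin_levels v B"
  shows "gen_fun (\<lambda>(x, y). w x + v y) (A \<times> B) = gen_fun w A * gen_fun v B"
proof (rule fps_ext)
  fix n
  let ?C = "\<lambda>i. {x \<in> A. w x = i} \<times> {y \<in> B. v y = n - i}"
  have "{p \<in> A \<times> B. (case p of (x, y) \<Rightarrow> w x + v y) = n} = (\<Union>i\<in>{0..n}. ?C i)"
    by auto
  moreover have "card (\<Union>i\<in>{0..n}. ?C i) = (\<Sum>i=0..n. card (?C i))"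
    by (rule card_UN_disjoint) (use assms in \<open>auto simp: fin_levels_def\<close>)
  ultimately show "gen_fun (\<lambda>(x, y). w x + v y) (A \<times> B) $ n = (gen_fun w A * gen_fun v B) $ n"
    by (simp add: gen_fun_def fps_mult_nth card_cartesian_product)
qed

text \<open>The bound \<open>k \<le> w x\<close> ensures that the truncation in
  \<open>fps_suminf\<close> loses no element of weight \<open>n\<close>.\<close>

lemma gen_fun_UN:
  assumes "\<And>k. fin_levels w (S k)" "\<And>j k. j \<noteq> k \<Longrightarrow> S j \<inter> S k = {}"
    and "\<And>k x. x \<in> S k \<Longrightarrow> k \<le> w x"
  shows "gen_fun w (\<Union>k. S k) = fps_suminf (\<lambda>k. gen_fun w (S k))"
proof (rule fps_ext)
  fix n
  have "{x \<in> \<Union>k. S k. w x = n} = (\<Union>k\<le>n. {x \<in> S k. w x = n})"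
    using assms(3) by auto
  moreover have "card (\<Union>k\<le>n. {x \<in> S k. w x = n}) = (\<Sum>k\<le>n. card {x \<in> S k. w x = n})"
    by (rule card_UN_disjoint) (use assms in \<open>auto simp: fin_levels_def disjoint_iff\<close>)
  ultimately show "gen_fun w (\<Union>k. S k) $ n = fps_suminf (\<lambda>k. gen_fun w (S k)) $ n"
    by (simp add: gen_fun_def fps_suminf_def)
qed

section \<open>Generating functions of lists of parts\<close>

abbreviation desc :: "nat list \<Rightarrow> bool" where
  "desc \<equiv> sorted_wrt (\<ge>)"

definition Par :: "nat list set" where
  "Par = {xs. desc xs \<and> 0 \<notin> set xs}"

lemma length_le_sum_list: "0 \<notin> set xs \<Longrightarrow> length xs \<le> sum_list xs"
  by (induction xs) auto

lemma fin_levels_Par: "fin_levels sum_list Par"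
  unfolding fin_levels_def
proof
  fix n
  have "{xs \<in> Par. sum_list xs = n} \<subseteq> {xs. set xs \<subseteq> {..n} \<and> length xs \<le> n}"
    using length_le_sum_list member_le_sum_list by (fastforce simp: Par_def)
  then show "finite {xs \<in> Par. sum_list xs = n}"
    by (rule finite_subset) (rule finite_lists_length_le, simp)
qed

lemma fin_levels_lists_length: "fin_levels sum_list {xs :: nat list. desc xs \<and> length xs = k}"
  unfolding fin_levels_def
proof
  fix n
  have "{xs \<in> {xs. desc xs \<and> length xs = k}. sum_list xs = n} \<subseteq> {xs. set xs \<subseteq> {..n} \<and> length xs = k}"
    using member_le_sum_list by fastforce
  then show "finite {xs \<in> {xs. desc xs \<and> length xs = k}. sum_list xs = n}"
    by (rule finite_subset) (rule finite_lists_length_eq, simp)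
qed

text \<open>Nested induction on \<open>k\<close> and \<open>g\<close>: splitting on whether the
  largest part equals the bound reproduces \<open>hsym_Suc_Suc\<close>.\<close>

lemma gen_fun_lists_le:
  "gen_fun sum_list {xs. desc xs \<and> set xs \<subseteq> {1..g} \<and> length xs = k} = q ^ k * hsym k g"
proof (induction k arbitrary: g)
  case 0
  have "{xs. desc xs \<and> set xs \<subseteq> {1..g} \<and> length xs = 0} = {[]}"
    by auto
  then show ?case by (simp add: gen_fun_singleton)
next
  case (Suc k)
  let ?P = "\<lambda>k g. {xs. desc xs \<and> set xs \<subseteq> {1..g} \<and> length xs = k}"
  have fin: "fin_levels sum_list (?P k g)" for k g
    by (rule fin_levels_subset[OF fin_levels_lists_length[of k]]) auto
  show ?case
  proof (induction g)
    case 0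
    have "?P (Suc k) 0 = {}"
      by (auto simp: length_Suc_conv)
    then show ?case by (simp only: gen_fun_empty hsym_Suc_0 mult_zero_right)
  next
    case (Suc g)
    have split: "?P (Suc k) (Suc g) = ?P (Suc k) g \<union> (#) (Suc g) ` ?P k (Suc g)" (is "?A = ?B \<union> ?C")
    proof (intro equalityI subsetI)
      fix xs assume "xs \<in> ?A"
      then obtain x ys where "xs = x # ys" "desc (x # ys)" "set (x # ys) \<subseteq> {1..Suc g}" "length ys = k"
        by (auto simp: length_Suc_conv)
      then show "xs \<in> ?B \<union> ?C"
        by (cases "x = Suc g") force+
    qed (auto simp: subset_iff le_SucI)
    have "gen_fun sum_list ?A = gen_fun sum_list ?B + gen_fun sum_list ?C"
      by (rule gen_fun_Un[OF fin split]) auto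
    also have "gen_fun sum_list ?C = q ^ Suc g * gen_fun sum_list (?P k (Suc g))"
      by (rule gen_fun_image) auto
    finally show ?case
      using Suc.IH Suc.prems \<open>\<And>g. gen_fun sum_list (?P k g) = q ^ k * hsym k g\<close>
      by (simp add: hsym_Suc_Suc algebra_simps)
  qed
qed

lemma one_minus_X_power_Suc_neq_0: "1 - q ^ Suc k \<noteq> 0"
proof
  assume "1 - q ^ Suc k = 0"
  then have "(1 - q ^ Suc k) $ 0 = 0" by simp
  then show False by simp
qed

lemma one_minus_mult_eqI: "x = y + p * x \<Longrightarrow> (1 - p) * x = y" for x :: "int fps"
  by (metis add_diff_cancel_right' left_diff_distrib mult_1)

text \<open>Zeros are allowed, so these are partitions with at most \<open>k\<close> parts. Either a
  final 0 is dropped, or every entry is lowered by 1; the latter leads back to the same set and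
  yields the factor \<open>1 - q ^ Suc k\<close>.\<close>

lemma gen_fun_lists_length: "gen_fun sum_list {xs. desc xs \<and> length xs = k} = inv_qfact k"
proof (induction k)
  case 0
  have "{xs. desc xs \<and> length xs = 0} = {[]}"
    by auto
  then show ?case by (simp add: gen_fun_singleton)
next
  case (Suc k)
  let ?Q = "\<lambda>k. {xs. desc xs \<and> length xs = k}"
  have split: "?Q (Suc k) = (\<lambda>xs. xs @ [0]) ` ?Q k \<union> map Suc ` ?Q (Suc k)" (is "?A = ?B \<union> ?C")
  proof (intro equalityI subsetI)
    fix xs assume A: "xs \<in> ?A"
    then obtain ys y where xs: "xs = ys @ [y]"
      by (metis (mono_tags, lifting) length_Suc_conv_rev mem_Collect_eq)
    show "xs \<in> ?B \<union> ?C"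
    proof (cases y)
      case 0
      then show ?thesis using A xs by (auto simp: sorted_wrt_append)
    next
      case (Suc z)
      have pos: "\<forall>x\<in>set xs. 0 < x"
        using A xs Suc by (auto simp: sorted_wrt_append)
      then have "xs = map Suc (map (\<lambda>x. x - 1) xs)"
        by (simp add: map_idI)
      moreover have "desc (map (\<lambda>x. x - 1) xs)"
        unfolding sorted_wrt_map using A by (auto elim!: sorted_wrt_mono_rel[rotated])
      ultimately show ?thesis
        using A by (metis (mono_tags, lifting) UnI2 imageI length_map mem_Collect_eq)
    qed
  qed (auto simp: sorted_wrt_append sorted_wrt_map)
  have fin: "fin_levels sum_list (?Q (Suc k))"
    by (rule fin_levels_lists_length)
  have "gen_fun sum_list ?A = gen_fun sum_list ?B + gen_fun sum_list ?C"
  proof (rule gen_fun_Un[OF fin split])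
    have "0 \<in> set xs" if "xs \<in> ?B" for xs using that by auto
    moreover have "0 \<notin> set xs" if "xs \<in> ?C" for xs using that by auto
    ultimately show "?B \<inter> ?C = {}" by blast
  qed
  also have "gen_fun sum_list ?B = q ^ 0 * gen_fun sum_list (?Q k)"
    by (rule gen_fun_image) (auto intro: inj_onI)
  also have "gen_fun sum_list ?C = q ^ Suc k * gen_fun sum_list ?A"
  proof (rule gen_fun_image)
    show "inj_on (map Suc) ?A"
      by (rule inj_on_subset[OF inj_mapI]) auto
    show "sum_list (map Suc xs) = sum_list xs + Suc k" if "xs \<in> ?A" for xs
    proof -
      have "sum_list (map Suc xs) = sum_list xs + length xs" for xs
        by (induction xs) auto
      then show ?thesis using that by simp
    qed
  qed
  finally have "(1 - q ^ Suc k) * gen_fun sum_list ?A = inv_qfact k"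
    unfolding Suc.IH power_0 mult_1 by (rule one_minus_mult_eqI)
  also have "\<dots> = (1 - q ^ Suc k) * inv_qfact (Suc k)"
    using inv_qfact_Suc[of k] by (simp add: algebra_simps del: power_Suc)
  finally show ?case
    using one_minus_X_power_Suc_neq_0[of k] by simp
qed

text \<open>The same scheme, removing a part equal to the upper bound. The factor
  \<open>1 - q\<close> takes the parts 1 out of \<open>inv_qfact\<close>.\<close>

lemma gen_fun_lists_no_ones: "gen_fun sum_list {xs. desc xs \<and> set xs \<subseteq> {2..Suc g}} = (1 - q) * inv_qfact (Suc g)"
proof (induction g)
  case 0
  have "{xs. desc xs \<and> set xs \<subseteq> {2..Suc 0}} = {[]}"
    by auto
  then show ?case
    using inv_qfact_Suc[of 0] by (simp add: gen_fun_singleton algebra_simps)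
next
  case (Suc g)
  let ?R = "\<lambda>g. {xs. desc xs \<and> set xs \<subseteq> {2..Suc g}}"
  have fin: "fin_levels sum_list (?R g)" for g
    by (rule fin_levels_subset[OF fin_levels_Par]) (auto simp: Par_def)
  have split: "?R (Suc g) = ?R g \<union> (#) (Suc (Suc g)) ` ?R (Suc g)" (is "?A = ?B \<union> ?C")
  proof (intro equalityI subsetI)
    fix xs assume A: "xs \<in> ?A"
    show "xs \<in> ?B \<union> ?C"
    proof (cases xs)
      case (Cons x ys)
      then show ?thesis
        using A by (cases "x = Suc (Suc g)") force+
    qed simp
  qed (auto simp: subset_iff le_SucI)
  have "gen_fun sum_list ?A = gen_fun sum_list ?B + gen_fun sum_list ?C"
    by (rule gen_fun_Un[OF fin split]) auto
  also have "gen_fun sum_list ?C = q ^ Suc (Suc g) * gen_fun sum_list ?A"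
    by (rule gen_fun_image) auto
  finally have "(1 - q ^ Suc (Suc g)) * gen_fun sum_list ?A = (1 - q) * inv_qfact (Suc g)"
    unfolding Suc.IH by (rule one_minus_mult_eqI)
  also have "inv_qfact (Suc g) = (1 - q ^ Suc (Suc g)) * inv_qfact (Suc (Suc g))"
    using inv_qfact_Suc[of "Suc g"] by (simp add: algebra_simps del: power_Suc)
  finally have "(1 - q ^ Suc (Suc g)) * gen_fun sum_list ?A
      = (1 - q ^ Suc (Suc g)) * ((1 - q) * inv_qfact (Suc (Suc g)))"
    by (simp add: mult_ac)
  then show ?case
    using one_minus_X_power_Suc_neq_0[of "Suc g"] by simp
qed

lemma partitions_eq: "partitions n = {xs \<in> Par. sum_list xs = n}"
  by (auto simp: partitions_def Par_def) (metis gr0I)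

lemma gen_fun_Par_nth: "gen_fun sum_list {xs \<in> Par. P xs} $ n = int (card {xs \<in> partitions n. P xs})"
  by (simp add: gen_fun_def partitions_eq conj_ac)

lemma fin_levels_Par_Collect: "fin_levels sum_list {xs \<in> Par. P xs}"
  by (rule fin_levels_subset[OF fin_levels_Par]) auto

section \<open>Partitions by rank\<close>

definition hooks :: "nat \<Rightarrow> nat \<Rightarrow> nat list set" where
  "hooks k g = {xs \<in> Par. length xs = Suc k \<and> hd xs = g}"

text \<open>Removing the largest part leaves \<open>k\<close> parts bounded by it. Length and
  largest part fix the first hook of the diagram, hence the rank.\<close>

lemma gen_fun_hooks: "gen_fun sum_list (hooks k (Suc g)) = q ^ (Suc g + k) * hsym k (Suc g)"
proof -
  have "hooks k (Suc g) = (#) (Suc g) ` {xs. desc xs \<and> set xs \<subseteq> {1..Suc g} \<and> length xs = k}"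
  proof (intro equalityI subsetI)
    fix xs assume "xs \<in> hooks k (Suc g)"
    then show "xs \<in> (#) (Suc g) ` {xs. desc xs \<and> set xs \<subseteq> {1..Suc g} \<and> length xs = k}"
      by (cases xs) (auto simp: hooks_def Par_def intro!: imageI Suc_leI gr0I)
  qed (auto simp: hooks_def Par_def subset_iff)
  moreover have "gen_fun sum_list ((#) (Suc g) ` {xs. desc xs \<and> set xs \<subseteq> {1..Suc g} \<and> length xs = k})
      = q ^ Suc g * gen_fun sum_list {xs. desc xs \<and> set xs \<subseteq> {1..Suc g} \<and> length xs = k}"
    by (rule gen_fun_image) auto
  ultimately show ?thesis
    by (simp only: gen_fun_lists_le power_add mult.assoc)
qed

lemma gen_fun_UN_hooks:
  assumes "inj k" "\<And>j. j \<le> k j"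
  shows "gen_fun sum_list (\<Union>j. hooks (k j) (g j)) = fps_suminf (\<lambda>j. gen_fun sum_list (hooks (k j) (g j)))"
proof (rule gen_fun_UN)
  show "fin_levels sum_list (hooks (k j) (g j))" for j
    unfolding hooks_def by (rule fin_levels_Par_Collect)
  show "hooks (k i) (g i) \<inter> hooks (k j) (g j) = {}" if "i \<noteq> j" for i j
    using injD[OF assms(1)] that by (auto simp: hooks_def)
  show "j \<le> sum_list xs" if "xs \<in> hooks (k j) (g j)" for j xs
    using that length_le_sum_list[of xs] assms(2)[of j] by (simp add: hooks_def Par_def)
qed

lemma prank_hooks:
  assumes "xs \<in> Par" "xs \<noteq> []"
  shows "xs \<in> hooks (length xs - 1) (hd xs)" "0 < hd xs" "0 < length xs"
    "prank xs = int (hd xs) - int (length xs)"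
  using assms by (cases xs; auto simp: hooks_def Par_def prank_def largest_part_def)+

text \<open>Splits off the empty partition, which has rank 0 but no first hook.\<close>

lemma gen_fun_Nil_Un:
  assumes "fin_levels sum_list {xs \<in> Par. P xs}" "[] \<notin> B"
    and "\<And>xs. xs \<noteq> [] \<Longrightarrow> xs \<in> Par \<and> P xs \<longleftrightarrow> xs \<in> B"
  shows "gen_fun sum_list {xs \<in> Par. P xs} = (if P [] then 1 else 0) + gen_fun sum_list B"
proof -
  have "gen_fun sum_list {xs \<in> Par. P xs} = gen_fun sum_list (if P [] then {[]} else {}) + gen_fun sum_list B"
  proof (rule gen_fun_Un[OF assms(1)])
    have "[] \<in> Par" by (simp add: Par_def)
    then have "xs \<in> Par \<and> P xs \<longleftrightarrow> xs \<in> (if P [] then {[]} else {}) \<union> B" for xs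
      using assms(2) assms(3)[of xs] by (cases "xs = []") auto
    then show "{xs \<in> Par. P xs} = (if P [] then {[]} else {}) \<union> B"
      by blast
  qed (use assms(2) in auto)
  then show ?thesis by (simp add: gen_fun_singleton)
qed

lemma gen_fun_prank: "gen_fun sum_list {xs \<in> Par. prank xs = int c} = rank_gen_fun c"
proof -
  have "gen_fun sum_list {xs \<in> Par. prank xs = int c}
      = (if prank [] = int c then 1 else 0) + gen_fun sum_list (\<Union>j. hooks j (Suc (j + c)))"
  proof (rule gen_fun_Nil_Un[OF fin_levels_Par_Collect])
    show "xs \<in> Par \<and> prank xs = int c \<longleftrightarrow> xs \<in> (\<Union>j. hooks j (Suc (j + c)))" if "xs \<noteq> []" for xs
    proof
      assume A: "xs \<in> Par \<and> prank xs = int c"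
      then have "hd xs = Suc (length xs - 1 + c)"
        using prank_hooks[of xs] that by linarith
      then show "xs \<in> (\<Union>j. hooks j (Suc (j + c)))"
        using prank_hooks(1)[of xs] A that by auto
    qed (use prank_hooks(4) that in \<open>auto simp: hooks_def\<close>)
  qed (auto simp: hooks_def)
  also have "gen_fun sum_list (\<Union>j. hooks j (Suc (j + c))) = fps_suminf (\<lambda>j. q ^ (2 * j + 1 + c) * qbinom (2 * j + c) j)"
    by (subst gen_fun_UN_hooks) (auto simp: gen_fun_hooks hsym_def add_ac mult_2 simp del: power_Suc)
  finally show ?thesis
    by (simp add: rank_gen_fun_hooks prank_def largest_part_def)
qed

text \<open>Here \<open>Suc j\<close> is the largest part rather than the number of parts;
  \<open>qbinom_sym\<close> takes the place of conjugation.\<close>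

lemma gen_fun_prank_uminus: "gen_fun sum_list {xs \<in> Par. prank xs = - int c} = rank_gen_fun c"
proof -
  have "gen_fun sum_list {xs \<in> Par. prank xs = - int c}
      = (if prank [] = - int c then 1 else 0) + gen_fun sum_list (\<Union>j. hooks (j + c) (Suc j))"
  proof (rule gen_fun_Nil_Un[OF fin_levels_Par_Collect])
    show "xs \<in> Par \<and> prank xs = - int c \<longleftrightarrow> xs \<in> (\<Union>j. hooks (j + c) (Suc j))" if "xs \<noteq> []" for xs
    proof
      assume A: "xs \<in> Par \<and> prank xs = - int c"
      then have "length xs - 1 = hd xs - 1 + c" "hd xs = Suc (hd xs - 1)"
        using prank_hooks[of xs] that by linarith+
      then show "xs \<in> (\<Union>j. hooks (j + c) (Suc j))"
        using prank_hooks(1)[of xs] A that by (metis UN_I UNIV_I)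
    qed (use prank_hooks(4) that in \<open>auto simp: hooks_def\<close>)
  qed (auto simp: hooks_def)
  also have "gen_fun sum_list (\<Union>j. hooks (j + c) (Suc j)) = fps_suminf (\<lambda>j. q ^ (2 * j + 1 + c) * qbinom (2 * j + c) j)"
  proof (subst gen_fun_UN_hooks)
    have "qbinom (2 * j + c) (j + c) = qbinom (2 * j + c) j" for j
      using qbinom_sym[of j "j + c"] by (simp add: mult_2 add.assoc)
    then show "fps_suminf (\<lambda>j. gen_fun sum_list (hooks (j + c) (Suc j)))
        = fps_suminf (\<lambda>j. q ^ (2 * j + 1 + c) * qbinom (2 * j + c) j)"
      by (simp add: gen_fun_hooks hsym_def mult_2 add_ac del: power_Suc)
  qed (auto intro: injI)
  finally show ?thesis
    by (simp add: rank_gen_fun_hooks prank_def largest_part_def)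
qed

section \<open>Partitions by crank\<close>

definition crank_class :: "nat \<Rightarrow> nat \<Rightarrow> nat list set" where
  "crank_class w i = {xs \<in> Par. omega xs = w \<and> length (filter (\<lambda>x. x > w) xs) = i}"

lemma desc_filter_append: "desc xs \<Longrightarrow> filter (\<lambda>x. x > t) xs @ filter (\<lambda>x. x \<le> t) xs = xs"
proof (induction xs)
  case (Cons x xs)
  show ?case
  proof (cases "x > t")
    case False
    then have "filter (\<lambda>x. x > t) xs = []"
      using Cons by (auto simp: filter_empty_conv)
    then show ?thesis using Cons False by simp
  qed (use Cons in simp)
qed simp

lemma sum_list_map_plus: "sum_list (map (\<lambda>z. z + c) xs) = sum_list xs + length xs * (c :: nat)"
  by (induction xs) auto

text \<open>Put \<open>w = Suc g\<close>. The \<open>i\<close> parts above \<open>w\<close>, each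
  lowered by \<open>w + 1\<close>, form an arbitrary descending list of length \<open>i\<close> with
  zeros allowed; the parts in \<open>{2..w}\<close> are free, and the \<open>w\<close> ones are
  fixed.\<close>

lemma gen_fun_crank_class:
  "gen_fun sum_list (crank_class (Suc g) i) = (1 - q) * (q ^ (i * Suc (Suc g) + Suc g) * (inv_qfact i * inv_qfact (Suc g)))"
proof -
  let ?w = "Suc g"
  let ?A = "{xs. desc xs \<and> length xs = i}" and ?B = "{xs. desc xs \<and> set xs \<subseteq> {2..?w}}"
  define f where "f = (\<lambda>(x, y). map (\<lambda>z. z + Suc ?w) x @ y @ replicate ?w (1::nat))"
  have finB: "fin_levels sum_list ?B"
    by (rule fin_levels_subset[OF fin_levels_Par]) (auto simp: Par_def)
  have f_in: "f p \<in> crank_class ?w i" if "p \<in> ?A \<times> ?B" for p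
  proof -
    obtain x y where p: "p = (x, y)" "desc x" "length x = i" "desc y" "set y \<subseteq> {2..?w}"
      using \<open>p \<in> ?A \<times> ?B\<close> by auto
    have "count_list (map (\<lambda>z. z + Suc ?w) x) 1 = 0" "count_list y 1 = 0"
      using p(5) by (auto simp: count_list_0_iff)
    moreover have "count_list (replicate k (1 :: nat)) 1 = k" for k
      by (induction k) auto
    ultimately have "omega (f p) = ?w"
      by (simp only: f_def p(1) omega_def count_list_append prod.case)
    moreover have "filter (\<lambda>x. x > ?w) (f p) = map (\<lambda>z. z + Suc ?w) x"
    proof -
      have "filter (\<lambda>x. x > ?w) (map (\<lambda>z. z + Suc ?w) x) = map (\<lambda>z. z + Suc ?w) x"
        by (rule filter_True) auto
      moreover have "filter (\<lambda>x. x > ?w) (y @ replicate ?w 1) = []"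
        using p(5) by (auto simp: filter_empty_conv)
      ultimately show ?thesis
        by (simp add: f_def p(1) del: replicate_Suc)
    qed
    moreover have "desc (f p)"
    proof -
      have "desc (map (\<lambda>z. z + Suc ?w) x)"
        using p(2) by (simp add: sorted_wrt_map)
      moreover have "desc (replicate k (1 :: nat))" for k
        by (induction k) auto
      moreover have "1 \<le> a \<and> a \<le> ?w" if "a \<in> set y" for a
        using p(5) that by auto
      then have "\<forall>a\<in>set y. \<forall>b\<in>set (replicate ?w 1). b \<le> a"
        and "\<forall>a\<in>set (map (\<lambda>z. z + Suc ?w) x). \<forall>b\<in>set (y @ replicate ?w 1). b \<le> a"
        by fastforce+
      ultimately show ?thesis
        using p(4) by (simp only: f_def p(1) prod.case sorted_wrt_append)
    qed
    moreover have "0 \<notin> set (f p)"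
      using p by (auto simp: f_def)
    ultimately show ?thesis
      using p(3) by (simp add: crank_class_def Par_def)
  qed
  have f_surj: "xs \<in> f ` (?A \<times> ?B)" if xs: "xs \<in> crank_class ?w i" for xs
  proof -
    have d: "desc xs" and z: "0 \<notin> set xs" and w: "count_list xs 1 = ?w"
      and len: "length (filter (\<lambda>x. x > ?w) xs) = i"
      using xs by (auto simp: crank_class_def Par_def omega_def)
    define l where "l = filter (\<lambda>x. x \<le> ?w) xs"
    define x where "x = map (\<lambda>z. z - Suc ?w) (filter (\<lambda>x. x > ?w) xs)"
    define y where "y = filter (\<lambda>x. x > 1) l"
    have dl: "desc l"
      unfolding l_def by (rule sorted_wrt_filter[OF d])
    have "filter (\<lambda>x. x \<le> 1) l = filter ((=) 1) xs"
      unfolding l_def filter_filter by (rule filter_cong) (use z in \<open>auto simp: le_Suc_eq\<close>)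
    also have "\<dots> = replicate ?w 1"
    proof -
      have "length (filter ((=) 1) xs) = ?w"
        using w by (simp only: count_list_eq_length_filter)
      moreover have "replicate (length (filter ((=) 1) xs)) 1 = filter ((=) 1) xs"
        by (rule replicate_length_same) auto
      ultimately show ?thesis by (simp only:)
    qed
    finally have "l = y @ replicate ?w 1"
      using desc_filter_append[OF dl, of 1] by (simp add: y_def)
    moreover have "filter (\<lambda>x. x > ?w) xs = map (\<lambda>z. z + Suc ?w) x"
      unfolding x_def map_map by (rule map_idI[symmetric]) auto
    ultimately have "xs = f (x, y)"
      using desc_filter_append[OF d, of ?w] by (simp add: f_def l_def)
    moreover have "desc (filter (\<lambda>x. x > ?w) xs)"
      by (rule sorted_wrt_filter[OF d])
    then have "desc x"
      unfolding x_def sorted_wrt_map by (rule sorted_wrt_mono_rel[rotated]) auto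
    moreover have "length x = i"
      using len by (simp add: x_def)
    moreover have "desc y"
      unfolding y_def by (rule sorted_wrt_filter[OF dl])
    moreover have "set y \<subseteq> {2..?w}"
      by (auto simp: y_def l_def)
    ultimately show ?thesis by blast
  qed
  have inj: "inj_on f (?A \<times> ?B)"
  proof (rule inj_onI)
    fix p p' assume p: "p \<in> ?A \<times> ?B" and p': "p' \<in> ?A \<times> ?B" and eq: "f p = f p'"
    \<comment> \<open>Both first blocks have length \<open>i\<close>, so equal concatenations can be
      split.\<close>
    have "map (\<lambda>z. z + Suc ?w) (fst p) = map (\<lambda>z. z + Suc ?w) (fst p') \<and>
        snd p @ replicate ?w 1 = snd p' @ replicate ?w 1"
      using eq p p' by (subst append_eq_append_conv[symmetric])
        (auto simp: f_def split_beta simp del: replicate_Suc append_eq_append_conv)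
    then show "p = p'"
      by (metis (no_types, lifting) add_right_cancel append_same_eq inj_map_eq_map injI prod_eqI)
  qed
  have "crank_class ?w i = f ` (?A \<times> ?B)"
    using f_in f_surj by blast
  moreover have "gen_fun sum_list (f ` (?A \<times> ?B))
      = q ^ (i * Suc ?w + ?w) * gen_fun (\<lambda>(x, y). sum_list x + sum_list y) (?A \<times> ?B)"
  proof (rule gen_fun_image[OF inj])
    fix p assume "p \<in> ?A \<times> ?B"
    then obtain x y where p: "p = (x, y)" "length x = i"
      by auto
    have "sum_list (f p) = (sum_list x + length x * Suc ?w) + (sum_list y + ?w * 1)"
      by (simp only: f_def p prod.case sum_list_append sum_list_map_plus sum_list_replicate of_nat_id
          mult.commute)
    then show "sum_list (f p) = (case p of (x, y) \<Rightarrow> sum_list x + sum_list y) + (i * Suc ?w + ?w)"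
      by (simp add: p)
  qed
  ultimately show ?thesis
    by (simp only: gen_fun_Times[OF fin_levels_lists_length finB] gen_fun_lists_length gen_fun_lists_no_ones mult_ac)
qed

lemma crank_gen_fun_summable: "fps_summable (\<lambda>k. q ^ (k * Suc (k + c) + k + c) * f k)"
  by (rule fps_summable_X_power_mult) simp

lemma gen_fun_UN_crank_class:
  assumes "inj w" "\<And>j. j \<le> w j"
  shows "gen_fun sum_list (\<Union>j. crank_class (w j) (i j)) = fps_suminf (\<lambda>j. gen_fun sum_list (crank_class (w j) (i j)))"
proof (rule gen_fun_UN)
  show "fin_levels sum_list (crank_class (w j) (i j))" for j
    unfolding crank_class_def by (rule fin_levels_Par_Collect)
  show "crank_class (w j) (i j) \<inter> crank_class (w k) (i k) = {}" if "j \<noteq> k" for j k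
    using injD[OF assms(1)] that by (auto simp: crank_class_def)
  show "j \<le> sum_list xs" if "xs \<in> crank_class (w j) (i j)" for j xs
  proof -
    have "w j = count_list xs 1" "0 \<notin> set xs"
      using that by (simp_all add: crank_class_def omega_def Par_def)
    then show ?thesis
      using assms(2)[of j] count_le_length[of xs 1] length_le_sum_list[of xs] by simp
  qed
qed

text \<open>The correction term only affects \<open>n = 1\<close>, where it accounts for the conventional values of \<open>M\<close>.\<close>
lemma gen_fun_no_ones:
  "gen_fun sum_list {xs \<in> Par. omega xs = 0 \<and> largest_part xs = c}
     = (1 - q) * (q ^ c * inv_qfact c) + (if c = 0 then q else if c = 1 then - q else 0)"
proof -
  consider "c = 0" | "c = 1" | d where "c = Suc (Suc d)"
    by (metis One_nat_def not0_implies_Suc)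
  then show ?thesis
  proof cases
    case 1
    then have "{xs \<in> Par. omega xs = 0 \<and> largest_part xs = c} = {[]}"
      by (auto simp: Par_def omega_def largest_part_def split: if_splits) (metis hd_in_set)
    then show ?thesis using 1 by (simp add: gen_fun_singleton)
  next
    case 2
    have "omega xs \<noteq> 0" if "largest_part xs = 1" for xs
      using that by (cases xs) (auto simp: omega_def largest_part_def)
    then have "{xs \<in> Par. omega xs = 0 \<and> largest_part xs = c} = {}"
      using 2 by blast
    then have "gen_fun sum_list {xs \<in> Par. omega xs = 0 \<and> largest_part xs = c} = 0"
      by (simp only: gen_fun_empty)
    moreover have "(1 - q) * inv_qfact 1 = 1"
      using inv_qfact_Suc[of 0] by (simp add: algebra_simps)
    then have "(1 - q) * (q * inv_qfact 1) = q"
      by (metis mult.left_commute mult.right_neutral)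
    ultimately show ?thesis unfolding 2 by simp
  next
    case 3
    have "{xs \<in> Par. omega xs = 0 \<and> largest_part xs = c}
        = (#) c ` {xs. desc xs \<and> set xs \<subseteq> {2..Suc (Suc d)}}"
    proof (intro equalityI subsetI)
      fix xs assume A: "xs \<in> {xs \<in> Par. omega xs = 0 \<and> largest_part xs = c}"
      then obtain ys where xs: "xs = c # ys"
        using 3 by (cases xs) (auto simp: largest_part_def)
      have "2 \<le> y" if "y \<in> set ys" for y
      proof -
        have "0 \<notin> set ys" "1 \<notin> set ys"
          using A by (auto simp: xs Par_def omega_def count_list_0_iff split: if_splits)
        then have "y \<noteq> 0" "y \<noteq> 1"
          using that by metis+
        then show ?thesis by simp
      qed
      then show "xs \<in> (#) c ` {xs. desc xs \<and> set xs \<subseteq> {2..Suc (Suc d)}}"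
        using A by (auto simp: xs Par_def 3)
    next
      fix xs assume "xs \<in> (#) c ` {xs. desc xs \<and> set xs \<subseteq> {2..Suc (Suc d)}}"
      then obtain ys where xs: "xs = c # ys" "desc ys" "set ys \<subseteq> {2..Suc (Suc d)}"
        by auto
      then have "0 \<notin> set ys" "1 \<notin> set ys"
        by auto
      then show "xs \<in> {xs \<in> Par. omega xs = 0 \<and> largest_part xs = c}"
        using xs by (auto simp: Par_def omega_def largest_part_def count_list_0_iff 3)
    qed
    moreover have "gen_fun sum_list ((#) c ` {xs. desc xs \<and> set xs \<subseteq> {2..Suc (Suc d)}})
        = q ^ c * gen_fun sum_list {xs. desc xs \<and> set xs \<subseteq> {2..Suc (Suc d)}}"
      by (rule gen_fun_image) auto
    ultimately show ?thesis
      by (simp only: gen_fun_lists_no_ones 3 mult.left_commute) simp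
  qed
qed

text \<open>Partitions without ones supply the term \<open>k = 0\<close> of the crank series up to
  the correction; those with \<open>Suc k\<close> ones and \<open>Suc k + c\<close> parts above
  \<open>Suc k\<close> supply the term \<open>Suc k\<close>.\<close>

lemma gen_fun_pcrank:
  "gen_fun sum_list {xs \<in> Par. pcrank xs = int c} = crank_gen_fun c + (if c = 0 then q else if c = 1 then - q else 0)"
proof -
  let ?S = "{xs \<in> Par. pcrank xs = int c}"
  let ?A = "{xs \<in> Par. omega xs = 0 \<and> largest_part xs = c}"
  let ?B = "\<Union>k. crank_class (Suc k) (Suc k + c)"
  let ?E = "\<lambda>k. q ^ (k * Suc (k + c) + k + c) * (inv_qfact k * inv_qfact (k + c))"
  have "gen_fun sum_list ?S = gen_fun sum_list ?A + gen_fun sum_list ?B"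
  proof (rule gen_fun_Un[OF fin_levels_Par_Collect])
    show "?S = ?A \<union> ?B"
    proof (intro equalityI subsetI)
      fix xs assume xs: "xs \<in> ?S"
      show "xs \<in> ?A \<union> ?B"
      proof (cases "omega xs")
        case 0
        then show ?thesis using xs by (simp add: pcrank_def)
      next
        case (Suc k)
        then have "length (filter (\<lambda>x. x > Suc k) xs) = Suc k + c"
          using xs by (auto simp: pcrank_def)
        then have "xs \<in> crank_class (Suc k) (Suc k + c)"
          using xs Suc by (simp add: crank_class_def)
        then show ?thesis by blast
      qed
    qed (auto simp: crank_class_def pcrank_def)
  qed (auto simp: crank_class_def)
  also have "gen_fun sum_list ?B = fps_suminf (\<lambda>k. gen_fun sum_list (crank_class (Suc k) (Suc k + c)))"
    by (rule gen_fun_UN_crank_class) auto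
  also have "(\<lambda>k. gen_fun sum_list (crank_class (Suc k) (Suc k + c))) = (\<lambda>k. (1 - q) * ?E (Suc k))"
  proof
    fix k
    have "(Suc k + c) * Suc (Suc k) + Suc k = Suc k * Suc (Suc k + c) + Suc k + c"
      by simp
    then show "gen_fun sum_list (crank_class (Suc k) (Suc k + c)) = (1 - q) * ?E (Suc k)"
      unfolding gen_fun_crank_class by (simp only: mult.commute[of "inv_qfact (Suc k + c)"])
  qed
  also have "fps_suminf (\<lambda>k. (1 - q) * ?E (Suc k)) = (1 - q) * fps_suminf (\<lambda>k. ?E (Suc k))"
    by (rule fps_suminf_mult[OF fps_summable_Suc[OF crank_gen_fun_summable]])
  also have "\<dots> = crank_gen_fun c - (1 - q) * (q ^ c * inv_qfact c)"
    unfolding crank_gen_fun_def fps_suminf_Suc[OF crank_gen_fun_summable] by (simp add: algebra_simps)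
  finally show ?thesis
    unfolding gen_fun_no_ones by simp
qed

text \<open>A negative crank forces a part 1, so no correction arises. The exponent
  \<open>i * w + i + w\<close> of a crank class is symmetric in \<open>i\<close> and
  \<open>w\<close>, so the terms are those of the series for crank \<open>c\<close>.\<close>

lemma gen_fun_pcrank_uminus:
  assumes "0 < c"
  shows "gen_fun sum_list {xs \<in> Par. pcrank xs = - int c} = crank_gen_fun c"
proof -
  let ?S = "{xs \<in> Par. pcrank xs = - int c}"
  have "?S = (\<Union>k. crank_class (k + c) k)"
  proof (intro equalityI subsetI)
    fix xs assume xs: "xs \<in> ?S"
    define k where "k = length (filter (\<lambda>x. x > omega xs) xs)"
    have "omega xs = k + c"
      using xs assms by (auto simp: pcrank_def k_def split: if_splits)
    then have "xs \<in> crank_class (k + c) k"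
      using xs by (simp add: crank_class_def k_def)
    then show "xs \<in> (\<Union>k. crank_class (k + c) k)" by blast
  qed (use assms in \<open>auto simp: crank_class_def pcrank_def\<close>)
  moreover have "gen_fun sum_list (\<Union>k. crank_class (k + c) k)
      = fps_suminf (\<lambda>k. gen_fun sum_list (crank_class (k + c) k))"
    by (rule gen_fun_UN_crank_class) (auto intro: injI)
  moreover have "gen_fun sum_list (crank_class (k + c) k)
      = (1 - q) * (q ^ (k * Suc (k + c) + k + c) * (inv_qfact k * inv_qfact (k + c)))" for k
  proof -
    obtain d where "k + c = Suc d"
      using assms by (metis add_is_0 gr0_conv_Suc not_gr0)
    then show ?thesis
      by (simp only: gen_fun_crank_class add.assoc)
  qed
  ultimately show ?thesis
    unfolding crank_gen_fun_def by (simp only: fps_suminf_mult[OF crank_gen_fun_summable])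
qed

lemma inv_qfact_nth_0: "inv_qfact k $ 0 = 1"
  by (induction k) (simp, subst inv_qfact_Suc, simp)

text \<open>Terms with \<open>k \<ge> 1\<close> have order above 1, so only \<open>k = 0\<close>
  contributes. The values are the conventional ones of \<open>M\<close> at 1.\<close>

lemma crank_gen_fun_nth_1: "crank_gen_fun c $ 1 = (if c = 0 then -1 else if c = 1 then 1 else 0)"
proof -
  let ?E = "\<lambda>k. q ^ (k * Suc (k + c) + k + c) * (inv_qfact k * inv_qfact (k + c))"
  have E1: "?E 1 $ 1 = 0"
    by (subst fps_X_power_mult_nth) simp
  have E0: "?E 0 $ j = (if j < c then 0 else inv_qfact c $ (j - c))" for j
    by (simp add: fps_X_power_mult_nth)
  have "crank_gen_fun c $ 1 = fps_suminf ?E $ 1 - fps_suminf ?E $ 0"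
    by (simp add: crank_gen_fun_def left_diff_distrib)
  also have "\<dots> = ?E 0 $ 1 + ?E 1 $ 1 - ?E 0 $ 0"
    by (simp add: fps_suminf_def)
  also have "\<dots> = (if c = 0 then -1 else if c = 1 then 1 else 0)"
    unfolding E0 E1 by (auto simp: inv_qfact_nth_0)
  finally show ?thesis .
qed

section \<open>Comparison of coefficients\<close>

lemma N_eq_rank_gen_fun: "N (int c) n = rank_gen_fun c $ n" "N (- int c) n = rank_gen_fun c $ n"
  unfolding N_def gen_fun_Par_nth[symmetric] gen_fun_prank gen_fun_prank_uminus by (rule refl)+

text \<open>At \<open>n = 1\<close> the conventional values are compared directly; at every other
  \<open>n\<close> the correction in \<open>gen_fun_pcrank\<close> has coefficient zero.\<close>

lemma M_eq_crank_gen_fun: "M (int c) n = crank_gen_fun c $ n" "M (- int c) n = crank_gen_fun c $ n"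
proof -
  have *: "M (int c) n = crank_gen_fun c $ n"
    by (cases "n = 1")
      (auto simp: M_def crank_gen_fun_nth_1 gen_fun_Par_nth[symmetric] gen_fun_pcrank fps_X_nth simp del: One_nat_def)
  then show "M (int c) n = crank_gen_fun c $ n" .
  show "M (- int c) n = crank_gen_fun c $ n"
  proof (cases "c = 0")
    case False
    then show ?thesis
      by (cases "n = 1")
        (auto simp: M_def crank_gen_fun_nth_1 gen_fun_Par_nth[symmetric] gen_fun_pcrank_uminus simp del: One_nat_def)
  qed (use * in simp)
qed

lemma sum_symmetric_interval:
  fixes f :: "int \<Rightarrow> int"
  assumes "\<And>c. f (int c) = g c" "\<And>c. f (- int c) = g c"
  shows "(\<Sum>r\<in>{- int m..int m}. f r) = g 0 + 2 * (\<Sum>c=1..m. g c)"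
proof (induction m)
  case 0
  show ?case using assms(1)[of 0] by simp
next
  case (Suc m)
  have "{- int (Suc m)..int (Suc m)} = insert (int (Suc m)) (insert (- int (Suc m)) {- int m..int m})"
    by auto
  then have "(\<Sum>r\<in>{- int (Suc m)..int (Suc m)}. f r) = 2 * g (Suc m) + (\<Sum>r\<in>{- int m..int m}. f r)"
    using assms(1)[of "Suc m"] assms(2)[of "Suc m"] by simp
  then show ?case
    using Suc by simp
qed

theorem mainTheorem2:
  fixes m n :: nat
  shows "N_le m n \<ge> M_le m n"
proof -
  have two: "(2 * f) $ n = 2 * f $ n" for f :: "int fps"
    by (simp only: mult_2 fps_add_nth)
  have "N_le m n - M_le m n
      = ((rank_gen_fun 0 - crank_gen_fun 0) + 2 * (\<Sum>c=1..m. rank_gen_fun c - crank_gen_fun c)) $ n"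
    unfolding N_le_def M_le_def
      sum_symmetric_interval[of "\<lambda>r. N r n", OF N_eq_rank_gen_fun]
      sum_symmetric_interval[of "\<lambda>r. M r n", OF M_eq_crank_gen_fun]
    by (simp add: two fps_sum_nth sum_subtractf)
  also have "\<dots> = 2 * diag_diff 0 m $ n"
    unfolding sum_rank_minus_crank by (rule two)
  also have "\<dots> \<ge> 0"
    using fps_nonneg_diag_diff[of 0 m] by (simp add: fps_nonneg_def)
  finally show ?thesis by simp
qed

end
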